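(* Let $(X_1,\mathbf{T}_1)$ be a free $\mathbb{Z}^{d_1}$-odometer and let $(X_2,T_2)$ be a free $\mathbb{Z}$-odometer. If $(X_1,\mathbf{T}_1)$ and $(X_2,T_2)$ are orbit equivalent, then for any cone $\mathsf{C}\subseteq\mathbb{Z}^{d_1}$ there is a $\mathsf{C}$-speedup $S:\mathbb{Z}\curvearrowright X_1$ of $\mathbf{T}_1$ that is topologically conjugate to $T_2$.
   Context: A $\mathbb{Z}^d$-action $\mathbf{T}:\mathbb{Z}^d\curvearrowright X$ on a topological space $X$ assigns to each $\mathbf{v}\in\mathbb{Z}^d$ a homeomorphism $\mathbf{T}^{\mathbf{v}}:X\to X$ with $\mathbf{T}^{\mathbf{v}+\mathbf{w}}=\mathbf{T}^{\mathbf{v}}\circ\mathbf{T}^{\mathbf{w}}$ and $\mathbf{T}^{\mathbf{0}}=\mathrm{id}$. It is free if $\mathbf{T}^{\mathbf{v}}(x)=x$ for some $x$ implies $\mathbf{v}=\mathbf{0}$. Actions $\mathbf{T}:\mathbb{Z}^d\curvearrowright X$ and $\mathbf{S}:\mathbb{Z}^d\curvearrowright Y$ are (topologically) conjugate if there is a homeomorphism $\Phi:X\to Y$ with $\Phi\circ\mathbf{T}^{\mathbf{v}}=\mathbf{S}^{\mathbf{v}}\circ\Phi$ for all $\mathbf{v}$. Actions $\mathbf{T}:\mathbb{Z}^{d_1}\curvearrowright X$ and $\mathbf{S}:\mathbb{Z}^{d_2}\curvearrowright Y$ are orbit equivalent if there is a homeomorphism $\Phi:X\to Y$ such that $\Phi(\{\mathbf{T}^{\mathbf{v}}(x):\mathbf{v}\in\mathbb{Z}^{d_1}\})=\{\mathbf{S}^{\mathbf{v}}(\Phi(x)):\mathbf{v}\in\mathbb{Z}^{d_2}\}$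 for every $x\in X$. A filled cone is an open, connected subset of $\mathbb{R}^d$ whose boundary consists of (portions of) $d$ distinct hyperplanes passing through the origin; a cone is the intersection of a filled cone with $\mathbb{Z}^d-\{\mathbf{0}\}$. Cones are understood to be closed under addition. A cocycle for $\mathbf{T}:\mathbb{Z}^{d_1}\curvearrowright X$ is a function $\mathbf{p}:X\times\mathbb{Z}^{d_2}\to\mathbb{Z}^{d_1}$ with $\mathbf{p}(x,\mathbf{0})=\mathbf{0}$ and $\mathbf{p}(x,\mathbf{v})+\mathbf{p}(\mathbf{T}^{\mathbf{p}(x,\mathbf{v})}(x),\mathbf{w})=\mathbf{p}(x,\mathbf{v}+\mathbf{w})$ for all $x\in X$ and $\mathbf{v},\mathbf{w}\in\mathbb{Z}^{d_2}$. A speedup of $(X,\mathbf{T})$ is an action (by homeomorphisms) $\mathbf{S}:\mathbb{Z}^{d_2}\curvearrowright X$ with $\mathbf{S}^{\mathbf{v}}(x)=\mathbf{T}^{\mathbf{p}(x,\mathbf{v})}(x)$ for some cocycle $\mathbf{p}$ for $\mathbf{T}$ (the speedup cocycle). Given a cone $\mathsf{C}\subseteq\mathbb{Z}^{d_1}$, it is a $\mathsf{C}$-speedup if moreover $\mathbf{p}(x,\mathbf{e}_j)\in\mathsf{C}$ for all $x\in X$ and all standard basis vectors $\mathbf{e}_j$ of $\mathbb{Z}^{d_2}$. Let $\mathfrak{G}=\{G_j\}_{j\ge1}$ be a decreasing sequence of finite-index subgroups of $\mathbb{Z}^d$, and let $X_{\mathfrak{G}}=\varprojlim\mathbb{Z}^d/G_j$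 be the inverse limit along the quotient maps $\mathbb{Z}^d/G_{j+1}\to\mathbb{Z}^d/G_j$ (topologized as a subspace of the product of discrete spaces), with the action $\sigma_{\mathfrak{G}}^{\mathbf{v}}(\mathbf{x}_1,\mathbf{x}_2,\dots)=(\mathbf{x}_1+\mathbf{v},\mathbf{x}_2+\mathbf{v},\dots)$, the $j$-th coordinate taken mod $G_j$. A $\mathbb{Z}^d$-odometer is any $\mathbb{Z}^d$-action conjugate to some such $(X_{\mathfrak{G}},\sigma_{\mathfrak{G}})$. *)

theory Defs
  imports "HOL-Analysis.Analysis"
begin

text \<open>
  The group \<open>\<int>\<^sup>d\<close> is the type \<open>int ^ 'd\<close>, with \<open>d = CARD('d)\<close>; in particular
  a \<open>\<int>\<close>-action is an action of \<open>int ^ 1\<close>. Spaces are abstract topologies, so the values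
  of an action outside \<open>topspace X\<close> are irrelevant.
\<close>

definition zd_action :: "'a topology \<Rightarrow> (int ^ 'd \<Rightarrow> 'a \<Rightarrow> 'a) \<Rightarrow> bool" where
  "zd_action X T \<longleftrightarrow>
     (\<forall>v. homeomorphic_map X X (T v)) \<and>
     (\<forall>v w. \<forall>x \<in> topspace X. T (v + w) x = T v (T w x)) \<and>
     (\<forall>x \<in> topspace X. T 0 x = x)"

definition free_action :: "'a topology \<Rightarrow> (int ^ 'd \<Rightarrow> 'a \<Rightarrow> 'a) \<Rightarrow> bool" where
  "free_action X T \<longleftrightarrow> (\<forall>v. \<forall>x \<in> topspace X. T v x = x \<longrightarrow> v = 0)"

definition conjugate_actions ::
  "'a topology \<Rightarrow> (int ^ 'd \<Rightarrow> 'a \<Rightarrow> 'a) \<Rightarrow> 'b topology \<Rightarrow> (int ^ 'd \<Rightarrow> 'b \<Rightarrow> 'b) \<Rightarrow> bool" where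
  "conjugate_actions X T Y S \<longleftrightarrow>
     (\<exists>\<Phi>. homeomorphic_map X Y \<Phi> \<and> (\<forall>v. \<forall>x \<in> topspace X. \<Phi> (T v x) = S v (\<Phi> x)))"

definition orbit_equivalent ::
  "'a topology \<Rightarrow> (int ^ 'd \<Rightarrow> 'a \<Rightarrow> 'a) \<Rightarrow> 'b topology \<Rightarrow> (int ^ 'e \<Rightarrow> 'b \<Rightarrow> 'b) \<Rightarrow> bool" where
  "orbit_equivalent X T Y S \<longleftrightarrow>
     (\<exists>\<Phi>. homeomorphic_map X Y \<Phi> \<and>
        (\<forall>x \<in> topspace X. \<Phi> ` range (\<lambda>v. T v x) = range (\<lambda>v. S v (\<Phi> x))))"

definition zd_subgroup :: "(int ^ 'd) set \<Rightarrow> bool" where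
  "zd_subgroup G \<longleftrightarrow> 0 \<in> G \<and> (\<forall>v \<in> G. \<forall>w \<in> G. v + w \<in> G) \<and> (\<forall>v \<in> G. - v \<in> G)"

definition zd_quotient :: "(int ^ 'd) set \<Rightarrow> (int ^ 'd) set set" where
  "zd_quotient G = range (\<lambda>v. v +o G)"

definition decreasing_finite_index :: "(nat \<Rightarrow> (int ^ 'd) set) \<Rightarrow> bool" where
  "decreasing_finite_index G \<longleftrightarrow>
     (\<forall>j. zd_subgroup (G j) \<and> finite (zd_quotient (G j)) \<and> G (Suc j) \<subseteq> G j)"

text \<open>
  The quotient map \<open>\<int>\<^sup>d / H \<rightarrow> \<int>\<^sup>d / G\<close>, for subgroups \<open>H \<subseteq> G\<close>, sends a coset \<open>c\<close> to the
  sum of sets \<open>c + G\<close>: if \<open>c = v +o H\<close>, this is \<open>v +o G\<close>. Likewise, adding \<open>v\<close> to the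
  class \<open>u +o G\<close> translates it, as a subset of \<open>\<int>\<^sup>d\<close>, by \<open>v\<close>.
\<close>

definition odometer_space ::
  "(nat \<Rightarrow> (int ^ 'd) set) \<Rightarrow> (nat \<Rightarrow> (int ^ 'd) set) topology" where
  "odometer_space G =
     subtopology (product_topology (\<lambda>j. discrete_topology (zd_quotient (G j))) UNIV)
       {x. \<forall>j. x (Suc j) + G j = x j}"

definition odometer_action ::
  "int ^ 'd \<Rightarrow> (nat \<Rightarrow> (int ^ 'd) set) \<Rightarrow> (nat \<Rightarrow> (int ^ 'd) set)" where
  "odometer_action v x = (\<lambda>j. v +o x j)"

definition odometer :: "'a topology \<Rightarrow> (int ^ 'd \<Rightarrow> 'a \<Rightarrow> 'a) \<Rightarrow> bool" where
  "odometer X T \<longleftrightarrow>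
     zd_action X T \<and>
     (\<exists>G. decreasing_finite_index G \<and> conjugate_actions X T (odometer_space G) odometer_action)"

text \<open>
  The boundary of a filled cone lies in the union of \<open>d\<close> distinct hyperplanes through the
  origin, and each of these hyperplanes contributes a genuine portion of it, that is, a
  portion with nonempty interior relative to the hyperplane. Since any two hyperplanes
  through the origin share the origin, merely requiring a nonempty portion of each would
  let a half-space count. The requirement also excludes the empty set and the whole space.
  For \<open>d = 1\<close> the only hyperplane is \<open>{0}\<close>, and the filled cones are the two open half-lines.
\<close>

definition filled_cone :: "(real ^ 'd) set \<Rightarrow> bool" where
  "filled_cone F \<longleftrightarrow>
     open F \<and> connected F \<and>
     (\<exists>\<H>. card \<H> = CARD('d) \<and>
        (\<forall>H \<in> \<H>. \<exists>a. a \<noteq> 0 \<and> H = {x. a \<bullet> x = 0}) \<and>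
        frontier F \<subseteq> \<Union>\<H> \<and>
        (\<forall>H \<in> \<H>. \<exists>U. open U \<and> U \<inter> H \<noteq> {} \<and> U \<inter> H \<subseteq> frontier F))"

definition real_vec :: "int ^ 'd \<Rightarrow> real ^ 'd" where
  "real_vec v = (\<chi> i. real_of_int (v $ i))"

definition zd_cone :: "(int ^ 'd) set \<Rightarrow> bool" where
  "zd_cone C \<longleftrightarrow>
     (\<exists>F. filled_cone F \<and> C = {v. v \<noteq> 0 \<and> real_vec v \<in> F}) \<and>
     (\<forall>v \<in> C. \<forall>w \<in> C. v + w \<in> C)"

definition speedup_cocycle ::
  "'a topology \<Rightarrow> (int ^ 'd \<Rightarrow> 'a \<Rightarrow> 'a) \<Rightarrow> ('a \<Rightarrow> int ^ 'e \<Rightarrow> int ^ 'd) \<Rightarrow> bool" where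
  "speedup_cocycle X T p \<longleftrightarrow>
     (\<forall>x \<in> topspace X. p x 0 = 0 \<and>
        (\<forall>v w. p x v + p (T (p x v) x) w = p x (v + w)))"

definition cone_speedup ::
  "(int ^ 'd) set \<Rightarrow> 'a topology \<Rightarrow> (int ^ 'd \<Rightarrow> 'a \<Rightarrow> 'a) \<Rightarrow> (int ^ 'e \<Rightarrow> 'a \<Rightarrow> 'a) \<Rightarrow> bool" where
  "cone_speedup C X T S \<longleftrightarrow>
     zd_action X S \<and>
     (\<exists>p. speedup_cocycle X T p \<and>
        (\<forall>x \<in> topspace X. \<forall>v. S v x = T (p x v) x) \<and>
        (\<forall>x \<in> topspace X. \<forall>j. p x (axis j 1) \<in> C))"

end

theory Submission
  imports Defs
begin

text \<open>
  Both spaces can be described by cyclic labels: compatible families of residues modulo \<open>n 0\<close>,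
  \<open>n 1\<close>, \<open>\<dots>\<close>, each dividing the next, that separate points. Two spaces with
  labels for the same moduli are homeomorphic by matching labels
  (\<open>cyclic_levels_homeomorphic\<close>), and only the divisibility-cofinal class of the moduli, that
  is, the supernatural number, matters (\<open>cyclic_levels_relevel\<close>). For a
  \<open>\<int>\<close>-odometer, the generator adds one to all labels. The proof therefore has two
  independent parts.

  First, the space of a free \<open>\<int>\<^sup>d\<close>-odometer has labels such that adding one to all
  of them moves every point along its orbit by a vector of the cone (\<open>cone_numbering\<close>). Fix
  \<open>v\<close> in the cone and a point \<open>b\<close>. The cosets of each of the subgroups, taken
  deeper and deeper, are arranged in a tower that climbs by steps in the cone, with \<open>b\<close> at the
  bottom and \<open>T (- v) b\<close> at the top; the next tower is obtained by cutting this one into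
  columns and stacking them (\<open>tower_refinement\<close>). For this the columns of \<open>b\<close> and
  of \<open>T (- v) b\<close> must differ, and they do once the subgroup is deep enough: the sum of the
  steps of a tower and of \<open>v\<close> lies in the cone, so it is not zero
  (\<open>tower_top_nonzero\<close>). In the limit the step is defined at all points but \<open>T (- v)
  b\<close>, which is sent to \<open>b\<close> by the step \<open>v\<close>. Steps can be taken in the cone
  because a cone meets every coset of every finite-index subgroup (\<open>cone_meets_coset\<close>).

  Second, orbit equivalence forces the two supernatural numbers to agree
  (\<open>orbit_equivalence_cofinal\<close>). The generator of the \<open>\<int>\<close>-odometer,
  transported by the orbit equivalence, moves points along orbits of the
  \<open>\<int>\<^sup>d\<close>-odometer, with displacements that need not be continuous but are constant on
  countably many closed pieces. A compactness argument on these pieces shows that it preserves the invariant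
  measure of clopen sets (\<open>mass_image_eq\<close>); hence both odometers assign the same set of values
  to clopen sets, and these values determine the supernatural number.

  The speedup \<open>S\<close> is the second action transported by the homeomorphism that matches labels. It
  is conjugate to the second action by definition, its generator adds one to all labels, and freeness turns
  its displacements into a cocycle (\<open>speedup_by_freeness\<close>).
\<close>

section \<open>Compact spaces with cyclic labels\<close>

text \<open>
  This is what remains of a \<open>\<int>\<close>-odometer when the action is forgotten: \<open>l j\<close>
  names the class of a point modulo \<open>n j\<close>. In such a space a point is the same thing as a
  compatible sequence of residues, so two spaces with the same moduli are homeomorphic by matching labels.
  The topology enters only through compactness and clopen fibres; together with separation of points this
  forces the fibres to form a base.
\<close>
locale cyclic_levels =
  fixes X :: "'a topology" and n :: "nat \<Rightarrow> nat" and l :: "nat \<Rightarrow> 'a \<Rightarrow> nat"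
  assumes compact: "compact_space X"
    and pos: "0 < n j"
    and dvd_Suc: "n j dvd n (Suc j)"
    and label_less: "x \<in> topspace X \<Longrightarrow> l j x < n j"
    and label_Suc: "x \<in> topspace X \<Longrightarrow> l (Suc j) x mod n j = l j x"
    and label_surj: "r < n j \<Longrightarrow> \<exists>x\<in>topspace X. l j x = r"
    and open_fibre: "openin X {x \<in> topspace X. l j x = r}"
    and separating: "\<lbrakk>x \<in> topspace X; y \<in> topspace X; \<And>j. l j x = l j y\<rbrakk> \<Longrightarrow> x = y"
begin

lemma dvd_le: "i \<le> j \<Longrightarrow> n i dvd n j"
  by (induction j rule: dec_induct) (auto intro: dvd_trans dvd_Suc)

lemma label_mod: "i \<le> j \<Longrightarrow> x \<in> topspace X \<Longrightarrow> l j x mod n i = l i x"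
proof (induction j rule: dec_induct)
  case base
  then show ?case by (simp add: label_less)
next
  case (step j)
  have "l (Suc j) x mod n i = (l (Suc j) x mod n j) mod n i"
    using dvd_le[OF step(1)] by (simp add: mod_mod_cancel)
  then show ?case using step label_Suc by simp
qed

lemma label_eq_le:
  "\<lbrakk>i \<le> j; x \<in> topspace X; y \<in> topspace X; l j x = l j y\<rbrakk> \<Longrightarrow> l i x = l i y"
  by (metis label_mod)

lemma open_saturated:
  assumes "\<And>x y. \<lbrakk>P x; x \<in> topspace X; y \<in> topspace X; l j x = l j y\<rbrakk> \<Longrightarrow> P y"
  shows "openin X {x \<in> topspace X. P x}"
proof -
  have "{x \<in> topspace X. P x} = (\<Union>r\<in>l j ` {x \<in> topspace X. P x}. {x \<in> topspace X. l j x = r})"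
    using assms by (auto simp: image_iff)
  then show ?thesis using open_fibre by (metis (no_types, lifting) imageE openin_Union)
qed

text \<open>
  The uniformity that compactness provides: a property that each point of a closed set acquires at some
  level, never loses at deeper levels, and that only depends on the label at its level, holds at a single
  level for the whole set. Otherwise the sets of exceptions would be nonempty, closed and decreasing, and a
  common point would never acquire the property.
\<close>
lemma uniform_level:
  assumes K: "closedin X K"
    and ex: "\<And>x. x \<in> K \<Longrightarrow> \<exists>j. P j x"
    and up: "\<And>i j x. \<lbrakk>i \<le> j; x \<in> topspace X; P i x\<rbrakk> \<Longrightarrow> P j x"
    and sat: "\<And>j x y. \<lbrakk>P j x; x \<in> topspace X; y \<in> topspace X; l j x = l j y\<rbrakk> \<Longrightarrow> P j y"
  shows "\<exists>j. \<forall>x\<in>K. P j x"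
proof (rule ccontr)
  assume neg: "\<not> ?thesis"
  have KX: "K \<subseteq> topspace X" using K closedin_subset by auto
  define D where "D j = K - {x \<in> topspace X. P j x}" for j
  have "closedin X (D j)" for j
    unfolding D_def using sat by (intro closedin_diff K open_saturated[where j=j]) blast
  moreover have "D j \<noteq> {}" for j
    using neg KX unfolding D_def by blast
  moreover have "decseq D"
    unfolding decseq_def D_def using up by blast
  ultimately have "(\<Inter>j. D j) \<noteq> {}"
    by (intro compact_space_imp_nest[OF compact])
  then show False using ex KX unfolding D_def by blast
qed

lemma fibre_neighbourhood:
  assumes "openin X U" "x \<in> U"
  shows "\<exists>j. \<forall>y\<in>topspace X. l j y = l j x \<longrightarrow> y \<in> U"
proof -
  have x: "x \<in> topspace X" using assms openin_subset by auto
  have "\<exists>j. \<forall>y\<in>topspace X - U. l j y \<noteq> l j x"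
  proof (rule uniform_level)
    show "closedin X (topspace X - U)" using assms by blast
    show "\<exists>j. l j y \<noteq> l j x" if "y \<in> topspace X - U" for y
      using separating[of y x] that x assms(2) by blast
    show "l j y \<noteq> l j x" if "i \<le> j" "y \<in> topspace X" "l i y \<noteq> l i x" for i j y
      using that label_eq_le x by metis
  qed auto
  then show ?thesis by blast
qed

lemma disjoint_closed_separated:
  assumes "closedin X K" "closedin X L" "K \<inter> L = {}"
  shows "\<exists>j. l j ` K \<inter> l j ` L = {}"
proof -
  have sub: "K \<subseteq> topspace X" "L \<subseteq> topspace X" using assms closedin_subset by auto
  have "\<exists>j. \<forall>x\<in>K. \<forall>y\<in>L. l j y \<noteq> l j x"
  proof (rule uniform_level[OF assms(1)])
    show "\<exists>j. \<forall>y\<in>L. l j y \<noteq> l j x" if "x \<in> K" for x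
      using fibre_neighbourhood[of "topspace X - L" x] that assms sub by blast
    show "\<forall>y\<in>L. l j y \<noteq> l j x" if "i \<le> j" "x \<in> topspace X" "\<forall>y\<in>L. l i y \<noteq> l i x" for i j x
      using that label_eq_le sub by (metis subsetD)
    show "\<forall>z\<in>L. l j z \<noteq> l j y"
      if "\<forall>z\<in>L. l j z \<noteq> l j x" "l j x = l j y" for j x y using that by auto
  qed
  then obtain j where "\<forall>x\<in>K. \<forall>y\<in>L. l j y \<noteq> l j x" by blast
  then have "l j x \<noteq> l j y" if "x \<in> K" "y \<in> L" for x y using that by metis
  then have "l j ` K \<inter> l j ` L = {}" by auto
  then show ?thesis by blast
qed

lemma disjoint_labels_mono:
  assumes "i \<le> j" "K \<subseteq> topspace X" "L \<subseteq> topspace X" "l i ` K \<inter> l i ` L = {}"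
  shows "l j ` K \<inter> l j ` L = {}"
proof -
  have False if "x \<in> K" "y \<in> L" "l j x = l j y" for x y
    using label_eq_le[OF assms(1) _ _ that(3)] assms that by (metis disjoint_iff imageI subsetD)
  then show ?thesis by blast
qed

lemma Hausdorff: "Hausdorff_space X"
  unfolding Hausdorff_space_def
proof (intro allI impI)
  fix x y assume *: "x \<in> topspace X \<and> y \<in> topspace X \<and> x \<noteq> y"
  then obtain j where "l j x \<noteq> l j y" using separating by blast
  then have "disjnt {z \<in> topspace X. l j z = l j x} {z \<in> topspace X. l j z = l j y}"
    by (auto simp: disjnt_def)
  then show "\<exists>U V. openin X U \<and> openin X V \<and> x \<in> U \<and> y \<in> V \<and> disjnt U V"
    using * open_fibre[of j "l j x"] open_fibre[of j "l j y"] by blast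
qed

text \<open>
  Completeness: the fibres over a compatible sequence of labels are nested nonempty closed sets.
\<close>
lemma label_sequence_realised:
  assumes "\<And>j. r j < n j" "\<And>j. r (Suc j) mod n j = r j"
  shows "\<exists>x\<in>topspace X. \<forall>j. l j x = r j"
proof -
  define D where "D j = {x \<in> topspace X. l j x = r j}" for j
  have "closedin X (D j)" for j
  proof -
    have "openin X {x \<in> topspace X. l j x \<noteq> r j}"
      by (rule open_saturated[where j=j]) simp
    moreover have "topspace X - {x \<in> topspace X. l j x \<noteq> r j} = D j" by (auto simp: D_def)
    ultimately show ?thesis by (metis closedin_diff closedin_topspace)
  qed
  moreover have "D j \<noteq> {}" for j
    using label_surj[OF assms(1)] unfolding D_def by blast
  moreover have "decseq D"
    unfolding decseq_Suc_iff D_def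
  proof (intro allI subsetI)
    show "x \<in> {x \<in> topspace X. l i x = r i}" if "x \<in> {x \<in> topspace X. l (Suc i) x = r (Suc i)}" for i x
      using that assms(2)[of i] label_Suc[of x i] by simp
  qed
  ultimately have "(\<Inter>j. D j) \<noteq> {}"
    by (intro compact_space_imp_nest[OF compact])
  then show ?thesis unfolding D_def by blast
qed

lemma continuous_if_labels_match:
  assumes "cyclic_levels Y n m" "f ` topspace Y \<subseteq> topspace X"
    and "\<And>j y. y \<in> topspace Y \<Longrightarrow> l j (f y) = m j y"
  shows "continuous_map Y X f"
proof -
  interpret Y: cyclic_levels Y n m by fact
  have "openin Y {y \<in> topspace Y. f y \<in> U}" if U: "openin X U" for U
  proof (subst openin_subopen, intro ballI)
    fix y assume y: "y \<in> {y \<in> topspace Y. f y \<in> U}"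
    obtain j where j: "\<forall>z\<in>topspace X. l j z = l j (f y) \<longrightarrow> z \<in> U"
      using fibre_neighbourhood[OF U] y by blast
    have "{z \<in> topspace Y. m j z = m j y} \<subseteq> {y \<in> topspace Y. f y \<in> U}"
      using j assms y by auto
    then show "\<exists>T. openin Y T \<and> y \<in> T \<and> T \<subseteq> {y \<in> topspace Y. f y \<in> U}"
      using Y.open_fibre[of j "m j y"] y by blast
  qed
  then show ?thesis using assms(2) by (auto simp: continuous_map_def)
qed

end

text \<open>
  Matching labels is continuous in either direction because fibres are open and form a base.
\<close>
lemma cyclic_levels_homeomorphic:
  assumes "cyclic_levels X n l" "cyclic_levels Y n m"
  shows "\<exists>\<Theta>. homeomorphic_map X Y \<Theta> \<and> (\<forall>x\<in>topspace X. \<forall>j. m j (\<Theta> x) = l j x)"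
proof -
  interpret X: cyclic_levels X n l by fact
  interpret Y: cyclic_levels Y n m by fact
  have "\<exists>f. \<forall>x\<in>topspace X. f x \<in> topspace Y \<and> (\<forall>j. m j (f x) = l j x)"
  proof (intro bchoice ballI)
    show "\<exists>y. y \<in> topspace Y \<and> (\<forall>j. m j y = l j x)" if "x \<in> topspace X" for x
      using Y.label_sequence_realised[of "\<lambda>j. l j x"] X.label_less X.label_Suc that by blast
  qed
  then obtain f where f: "\<And>x. x \<in> topspace X \<Longrightarrow> f x \<in> topspace Y"
    "\<And>x j. x \<in> topspace X \<Longrightarrow> m j (f x) = l j x" by blast
  have "\<exists>g. \<forall>y\<in>topspace Y. g y \<in> topspace X \<and> (\<forall>j. l j (g y) = m j y)"
  proof (intro bchoice ballI)
    show "\<exists>x. x \<in> topspace X \<and> (\<forall>j. l j x = m j y)" if "y \<in> topspace Y" for y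
      using X.label_sequence_realised[of "\<lambda>j. m j y"] Y.label_less Y.label_Suc that by blast
  qed
  then obtain g where g: "\<And>x. x \<in> topspace Y \<Longrightarrow> g x \<in> topspace X"
    "\<And>x j. x \<in> topspace Y \<Longrightarrow> l j (g x) = m j x" by blast
  have "homeomorphic_maps X Y f g"
    unfolding homeomorphic_maps_def
  proof (intro conjI ballI)
    show "continuous_map X Y f"
      using f by (intro Y.continuous_if_labels_match[OF assms(1)]) auto
    show "continuous_map Y X g"
      using g by (intro X.continuous_if_labels_match[OF assms(2)]) auto
    show "g (f x) = x" if "x \<in> topspace X" for x
      using that f g by (intro X.separating) auto
    show "f (g y) = y" if "y \<in> topspace Y" for y
      using that f g by (intro Y.separating) auto
  qed
  then show ?thesis using f homeomorphic_map_maps by blast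
qed

text \<open>
  Moduli that are cofinal with \<open>m\<close> for divisibility describe the same space: read the label
  modulo \<open>n j\<close> off a level whose modulus is a multiple of \<open>n j\<close>. This is why only
  the supernatural number behind the moduli matters for conjugacy of \<open>\<int>\<close>-odometers.
\<close>
lemma cyclic_levels_relevel:
  assumes "cyclic_levels X m l"
    and n: "\<And>j. 0 < n j" "\<And>j. n j dvd n (Suc j)"
    and nm: "\<And>j. \<exists>k. n j dvd m k" and mn: "\<And>k. \<exists>j. m k dvd n j"
  obtains K where "cyclic_levels X n (\<lambda>j x. l (K j) x mod n j)" "\<And>j. n j dvd m (K j)"
proof -
  interpret X: cyclic_levels X m l by fact
  \<comment> \<open>Taking running maxima of the levels makes the new labels compatible with each other.\<close>
  obtain K0 where K0: "\<And>j. n j dvd m (K0 j)" using nm by metis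
  define K where "K j = Max (K0 ` {..j})" for j
  have K0_le: "K0 i \<le> K j" if "i \<le> j" for i j using that unfolding K_def by simp
  have K: "n j dvd m (K j)" for j
    using K0 X.dvd_le[OF K0_le[of j j]] dvd_trans by blast
  have monoK: "K i \<le> K j" if "i \<le> j" for i j
    using that unfolding K_def by (intro Max_mono) auto
  have red: "l k x mod n j = l (K j) x mod n j" if "K j \<le> k" "x \<in> topspace X" for k j x
    by (metis that X.label_mod K mod_mod_cancel)
  have "cyclic_levels X n (\<lambda>j x. l (K j) x mod n j)"
  proof
    show "l (K (Suc j)) x mod n (Suc j) mod n j = l (K j) x mod n j" if "x \<in> topspace X" for x j
      using red[OF monoK[of j "Suc j"] that] n(2)[of j] by (simp add: mod_mod_cancel)
    show "\<exists>x\<in>topspace X. l (K j) x mod n j = r" if "r < n j" for r j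
    proof -
      have "r < m (K j)" using that K[of j] X.pos[of "K j"] by (meson dvd_imp_le order.strict_trans2)
      then obtain x where "x \<in> topspace X" "l (K j) x = r" using X.label_surj by blast
      then show ?thesis using that by (metis mod_less)
    qed
    show "openin X {x \<in> topspace X. l (K j) x mod n j = r}" for j r
      by (rule X.open_saturated[where j="K j"]) auto
    show "x = y" if xy: "x \<in> topspace X" "y \<in> topspace X"
      and eq: "\<And>j. l (K j) x mod n j = l (K j) y mod n j" for x y
    proof (rule X.separating[OF xy])
      fix k
      obtain j where j: "m k dvd n j" using mn by blast
      let ?i = "max (K j) k"
      have "l ?i x mod n j = l ?i y mod n j"
        using red[of j ?i x] red[of j ?i y] xy eq[of j] by linarith
      then have "l ?i x mod n j mod m k = l ?i y mod n j mod m k" by simp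
      then have "l ?i x mod m k = l ?i y mod m k" by (simp only: mod_mod_cancel[OF j])
      then show "l k x = l k y" using X.label_mod xy by simp
    qed
  qed (use X.compact n in auto)
  then show ?thesis using that K by blast
qed

section \<open>The mass of clopen sets and its invariance along orbits\<close>

context cyclic_levels
begin

definition ratio :: "nat \<Rightarrow> 'a set \<Rightarrow> real" where
  "ratio j A = real (card (l j ` A)) / real (n j)"

text \<open>
  On clopen sets this is the probability measure that gives all fibres of a level equal weight; on closed
  sets it is the infimum over clopen neighbourhoods, since \<open>ratio j A\<close> is the measure of the
  union of the level-\<open>j\<close> fibres that meet \<open>A\<close>. Finite counting thus replaces the
  construction of a countably additive measure.
\<close>
definition mass :: "'a set \<Rightarrow> real" where
  "mass A = (INF j. ratio j A)"

definition saturated :: "nat \<Rightarrow> 'a set \<Rightarrow> bool" where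
  "saturated j A \<longleftrightarrow> A \<subseteq> topspace X \<and> (\<forall>x\<in>A. \<forall>y\<in>topspace X. l j y = l j x \<longrightarrow> y \<in> A)"

lemma finite_labels: "A \<subseteq> topspace X \<Longrightarrow> finite (l j ` A)"
  by (rule finite_subset[of _ "{..<n j}"]) (auto simp: label_less)

text \<open>
  Each class modulo \<open>n i\<close> splits into the same number of classes modulo \<open>n j\<close>.
  This makes \<open>ratio\<close> decrease with the level, and stay constant on unions of fibres.
\<close>
lemma card_residue_lift:
  assumes "i \<le> j" "B \<subseteq> {..<n i}"
  shows "real (card {r. r < n j \<and> r mod n i \<in> B}) / n j = real (card B) / n i"
proof -
  obtain q where q: "n j = n i * q" using dvd_le[OF assms(1)] by blast
  have ni: "n i > 0" "n j > 0" using pos by auto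
  have "bij_betw (\<lambda>(b, a). b + n i * a) (B \<times> {..<q}) {r. r < n j \<and> r mod n i \<in> B}"
  proof (rule bij_betwI[where g="\<lambda>r. (r mod n i, r div n i)"])
    show "(\<lambda>(b, a). b + n i * a) \<in> B \<times> {..<q} \<rightarrow> {r. r < n j \<and> r mod n i \<in> B}"
    proof safe
      fix b a assume *: "b \<in> B" "a < q"
      have "b < n i" using * assms by auto
      then have "b + n i * a < n i * Suc a" by simp
      also have "\<dots> \<le> n i * q" using *(2) by (intro mult_le_mono) auto
      finally show "b + n i * a < n j" using q by simp
      show "(b + n i * a) mod n i \<in> B" using * \<open>b < n i\<close> by simp
    qed
    show "(\<lambda>r. (r mod n i, r div n i)) \<in> {r. r < n j \<and> r mod n i \<in> B} \<rightarrow> B \<times> {..<q}"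
      using ni by (auto simp: q less_mult_imp_div_less mult.commute)
  qed (use assms in \<open>auto simp: subset_iff\<close>)
  then have "card {r. r < n j \<and> r mod n i \<in> B} = card B * q"
    by (auto dest!: bij_betw_same_card simp: card_cartesian_product)
  then show ?thesis using ni q by simp
qed

lemma ratio_antimono:
  assumes "i \<le> j" "A \<subseteq> topspace X"
  shows "ratio j A \<le> ratio i A"
proof -
  have "l j ` A \<subseteq> {r. r < n j \<and> r mod n i \<in> l i ` A}"
    using assms label_mod label_less by (auto simp: subset_iff)
  then have "card (l j ` A) \<le> card {r. r < n j \<and> r mod n i \<in> l i ` A}"
    by (intro card_mono) auto
  then have "ratio j A \<le> real (card {r. r < n j \<and> r mod n i \<in> l i ` A}) / n j"
    unfolding ratio_def by (intro divide_right_mono) auto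
  also have "\<dots> = ratio i A"
    unfolding ratio_def using assms label_less by (intro card_residue_lift) auto
  finally show ?thesis .
qed

lemma saturated_mono: "i \<le> j \<Longrightarrow> saturated i A \<Longrightarrow> saturated j A"
  unfolding saturated_def using label_eq_le by (meson subsetD)

lemma ratio_saturated:
  assumes "i \<le> j" "saturated i A"
  shows "ratio j A = ratio i A"
proof -
  have A: "A \<subseteq> topspace X" using assms by (simp add: saturated_def)
  have "l j ` A = {r. r < n j \<and> r mod n i \<in> l i ` A}"
  proof
    show "l j ` A \<subseteq> {r. r < n j \<and> r mod n i \<in> l i ` A}"
      using assms A label_mod label_less by (auto simp: subset_iff)
    show "{r. r < n j \<and> r mod n i \<in> l i ` A} \<subseteq> l j ` A"
    proof safe
      fix r x assume r: "r < n j" "r mod n i = l i x" "x \<in> A"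
      obtain y where y: "y \<in> topspace X" "l j y = r" using label_surj r by blast
      then have "l i y = l i x" using label_mod[OF assms(1), of y] r by simp
      then have "y \<in> A" using y r assms by (auto simp: saturated_def)
      then show "r \<in> l j ` A" using y by auto
    qed
  qed
  then show ?thesis
    unfolding ratio_def using A label_less assms(1) card_residue_lift[of i j "l i ` A"]
    by (auto simp: subset_iff)
qed

lemma ratio_nonneg: "0 \<le> ratio j A"
  by (simp add: ratio_def)

lemma bdd_ratio: "bdd_below (range (\<lambda>j. ratio j A))"
  using ratio_nonneg by (intro bdd_belowI[of _ 0]) auto

lemma mass_le_ratio: "mass A \<le> ratio j A"
  unfolding mass_def by (intro cINF_lower bdd_ratio) auto

lemma mass_saturated:
  assumes "saturated j A"
  shows "mass A = ratio j A"
proof (rule antisym[OF mass_le_ratio])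
  have A: "A \<subseteq> topspace X" using assms by (simp add: saturated_def)
  have "ratio j A \<le> ratio i A" for i
  proof (cases "i \<le> j")
    case True
    then show ?thesis using A by (rule ratio_antimono)
  next
    case False
    then show ?thesis using ratio_saturated[of j i A] assms by simp
  qed
  then show "ratio j A \<le> mass A" unfolding mass_def by (intro cINF_greatest) auto
qed

lemma ratio_approximates_mass:
  assumes "0 < e"
  obtains j where "ratio j A < mass A + e"
  using cINF_less_iff[of UNIV "\<lambda>j. ratio j A" "mass A + e"] bdd_ratio assms
  unfolding mass_def by fastforce

lemma clopen_saturated:
  assumes "closedin X A" "openin X A"
  shows "\<exists>j. saturated j A"
proof -
  obtain j where "l j ` A \<inter> l j ` (topspace X - A) = {}"
    using disjoint_closed_separated[of A "topspace X - A"] assms by blast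
  then have "saturated j A"
    using assms closedin_subset unfolding saturated_def by fastforce
  then show ?thesis by blast
qed

lemma saturated_closed:
  assumes "saturated j A" shows "closedin X A"
proof -
  have A: "A \<subseteq> topspace X" using assms by (simp add: saturated_def)
  have "openin X {x \<in> topspace X. x \<notin> A}"
    using assms unfolding saturated_def by (intro open_saturated[where j=j]) auto
  moreover have "topspace X - {x \<in> topspace X. x \<notin> A} = A" using A by auto
  ultimately show ?thesis by (metis closedin_diff closedin_topspace)
qed

lemma saturated_open:
  assumes "saturated j A" shows "openin X A"
proof -
  have A: "A \<subseteq> topspace X" using assms by (simp add: saturated_def)
  have "openin X {x \<in> topspace X. x \<in> A}"
    using assms unfolding saturated_def by (intro open_saturated[where j=j]) auto
  moreover have "{x \<in> topspace X. x \<in> A} = A" using A by auto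
  ultimately show ?thesis by simp
qed

lemma mass_subadditive:
  assumes "finite F" "\<And>v. v \<in> F \<Longrightarrow> saturated (k v) (U v)" "saturated i A"
    and cover: "A \<subseteq> (\<Union>v\<in>F. U v)"
  shows "mass A \<le> (\<Sum>v\<in>F. mass (U v))"
proof -
  define j where "j = Max (insert i (k ` F))"
  have j: "i \<le> j" "\<And>v. v \<in> F \<Longrightarrow> k v \<le> j" using assms(1) by (auto simp: j_def)
  have sat: "saturated j A" "\<And>v. v \<in> F \<Longrightarrow> saturated j (U v)"
    using j assms saturated_mono by blast+
  have "card (l j ` A) \<le> card (\<Union>v\<in>F. l j ` U v)"
  proof (rule card_mono)
    show "finite (\<Union>v\<in>F. l j ` U v)"
      using assms(1) sat(2) finite_labels unfolding saturated_def by blast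
    show "l j ` A \<subseteq> (\<Union>v\<in>F. l j ` U v)" using cover by blast
  qed
  also have "\<dots> \<le> (\<Sum>v\<in>F. card (l j ` U v))" using assms(1) by (rule card_UN_le)
  finally have "real (card (l j ` A)) \<le> (\<Sum>v\<in>F. real (card (l j ` U v)))"
    using of_nat_mono by fastforce
  then have "ratio j A \<le> (\<Sum>v\<in>F. ratio j (U v))"
    unfolding ratio_def sum_divide_distrib[symmetric] by (intro divide_right_mono) auto
  also have "\<dots> = (\<Sum>v\<in>F. mass (U v))"
    using mass_saturated[OF sat(2)] by (intro sum.cong) auto
  finally show ?thesis using mass_saturated[OF sat(1)] by simp
qed

text \<open>
  A level that separates each of the finitely many pairs also separates them all at once, because separation
  persists at deeper levels.
\<close>
lemma separate_family:
  assumes "finite F" "\<And>v. v \<in> F \<Longrightarrow> closedin X (K v)"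
    and disj: "\<And>v w. \<lbrakk>v \<in> F; w \<in> F; v \<noteq> w\<rbrakk> \<Longrightarrow> K v \<inter> K w = {}"
  shows "\<exists>j. \<forall>v\<in>F. \<forall>w\<in>F. v \<noteq> w \<longrightarrow> l j ` K v \<inter> l j ` K w = {}"
proof -
  have "\<exists>g. \<forall>p\<in>F \<times> F. fst p \<noteq> snd p \<longrightarrow> l (g p) ` K (fst p) \<inter> l (g p) ` K (snd p) = {}"
    using disjoint_closed_separated assms by (intro bchoice) auto
  then obtain g where g: "\<And>v w. \<lbrakk>v \<in> F; w \<in> F; v \<noteq> w\<rbrakk> \<Longrightarrow> l (g (v, w)) ` K v \<inter> l (g (v, w)) ` K w = {}"
    by fastforce
  have "l (Max (g ` (F \<times> F))) ` K v \<inter> l (Max (g ` (F \<times> F))) ` K w = {}"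
    if "v \<in> F" "w \<in> F" "v \<noteq> w" for v w
    using that assms(1,2) closedin_subset
    by (intro disjoint_labels_mono[OF _ _ _ g[OF that]] Max_ge) auto
  then show ?thesis by blast
qed

text \<open>
  Disjoint closed sets have disjoint label sets at a deep level, where counting is additive.
\<close>
lemma mass_superadditive:
  assumes F: "finite F" and cl: "\<And>v. v \<in> F \<Longrightarrow> closedin X (K v)"
    and disj: "\<And>v w. \<lbrakk>v \<in> F; w \<in> F; v \<noteq> w\<rbrakk> \<Longrightarrow> K v \<inter> K w = {}"
    and A: "saturated i A" "\<And>v. v \<in> F \<Longrightarrow> K v \<subseteq> A"
  shows "(\<Sum>v\<in>F. mass (K v)) \<le> mass A"
proof -
  obtain j0 where j0: "\<forall>v\<in>F. \<forall>w\<in>F. v \<noteq> w \<longrightarrow> l j0 ` K v \<inter> l j0 ` K w = {}"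
    using separate_family[of F K] F cl disj by blast
  define j where "j = max i j0"
  have KX: "K v \<subseteq> topspace X" if "v \<in> F" for v using cl that closedin_subset by blast
  have j: "\<forall>v\<in>F. \<forall>w\<in>F. v \<noteq> w \<longrightarrow> l j ` K v \<inter> l j ` K w = {}"
    using disjoint_labels_mono[of j0 j] j0 KX by (simp add: j_def)
  have sat: "saturated j A" using saturated_mono[of i j] A by (simp add: j_def)
  have AX: "A \<subseteq> topspace X" using A by (simp add: saturated_def)
  have "(\<Sum>v\<in>F. card (l j ` K v)) = card (\<Union>v\<in>F. l j ` K v)"
    using F j KX finite_labels by (intro card_UN_disjoint[symmetric]) auto
  also have "\<dots> \<le> card (l j ` A)"
    using finite_labels[OF AX] A(2) by (intro card_mono) auto
  finally have "(\<Sum>v\<in>F. real (card (l j ` K v))) \<le> real (card (l j ` A))"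
    by (metis of_nat_mono of_nat_sum)
  then have "(\<Sum>v\<in>F. ratio j (K v)) \<le> ratio j A"
    unfolding ratio_def sum_divide_distrib[symmetric] by (intro divide_right_mono) auto
  moreover have "(\<Sum>v\<in>F. mass (K v)) \<le> (\<Sum>v\<in>F. ratio j (K v))"
    by (intro sum_mono mass_le_ratio)
  ultimately show ?thesis using mass_saturated[OF sat] by simp
qed

lemma mass_complement:
  assumes "closedin X A" "openin X A"
  shows "mass (topspace X - A) = 1 - mass A"
proof -
  obtain i where i: "saturated i A" using clopen_saturated assms by blast
  have A: "A \<subseteq> topspace X" using i by (simp add: saturated_def)
  have iC: "saturated i (topspace X - A)"
    using i unfolding saturated_def by (metis Diff_iff Diff_subset)
  have "l i ` A \<inter> l i ` (topspace X - A) = {}" using i by (fastforce simp: saturated_def)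
  moreover have "l i ` A \<union> l i ` (topspace X - A) = {..<n i}"
    using A label_less label_surj by (auto simp: image_Un[symmetric] Un_absorb1 image_iff) metis
  ultimately have "card (l i ` A) + card (l i ` (topspace X - A)) = n i"
    by (metis A Diff_subset card_Un_disjoint card_lessThan finite_labels)
  then have "ratio i A + ratio i (topspace X - A) = 1"
    using pos[of i] by (simp add: ratio_def flip: add_divide_distrib of_nat_add)
  then show ?thesis using mass_saturated i iC by simp
qed

lemma mass_fibre: "r < n j \<Longrightarrow> mass {x \<in> topspace X. l j x = r} = 1 / n j"
proof -
  assume r: "r < n j"
  have "saturated j {x \<in> topspace X. l j x = r}" by (auto simp: saturated_def)
  moreover have "l j ` {x \<in> topspace X. l j x = r} = {r}" using label_surj[OF r] by auto
  ultimately show ?thesis using mass_saturated by (simp add: ratio_def)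
qed

lemma mass_UN:
  assumes "finite I" "\<And>r. r \<in> I \<Longrightarrow> closedin X (B r)" "\<And>r. r \<in> I \<Longrightarrow> openin X (B r)"
    and "\<And>r s. \<lbrakk>r \<in> I; s \<in> I; r \<noteq> s\<rbrakk> \<Longrightarrow> B r \<inter> B s = {}"
  shows "mass (\<Union>r\<in>I. B r) = (\<Sum>r\<in>I. mass (B r))"
proof -
  have "\<exists>k. \<forall>r\<in>I. saturated (k r) (B r)"
    using clopen_saturated assms by (intro bchoice) auto
  then obtain k where k: "\<And>r. r \<in> I \<Longrightarrow> saturated (k r) (B r)" by blast
  have "closedin X (\<Union>r\<in>I. B r)" "openin X (\<Union>r\<in>I. B r)"
    using assms by (auto intro: closedin_Union openin_Union)
  then obtain i where i: "saturated i (\<Union>r\<in>I. B r)" using clopen_saturated by blast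
  show ?thesis
  proof (rule antisym)
    show "mass (\<Union>r\<in>I. B r) \<le> (\<Sum>r\<in>I. mass (B r))"
      using assms(1) k i by (rule mass_subadditive) auto
    show "(\<Sum>r\<in>I. mass (B r)) \<le> mass (\<Union>r\<in>I. B r)"
      using assms i by (intro mass_superadditive) auto
  qed
qed

end

text \<open>
  The situation of a free \<open>\<int>\<^sup>d\<close>-odometer: each \<open>\<tau> v\<close> permutes the
  fibres of every level, so it preserves all counts. Countability of the index type is what lets a map that
  agrees with some \<open>\<tau> v\<close> at each point be cut into countably many pieces.
\<close>
locale level_permuting_action = cyclic_levels X n l
  for X :: "'a topology" and n :: "nat \<Rightarrow> nat" and l :: "nat \<Rightarrow> 'a \<Rightarrow> nat" +
  fixes \<tau> :: "'v \<Rightarrow> 'a \<Rightarrow> 'a"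
  assumes count: "countable (UNIV :: 'v set)"
    and \<tau>: "homeomorphic_map X X (\<tau> v)"
    and perm: "\<lbrakk>x \<in> topspace X; y \<in> topspace X\<rbrakk> \<Longrightarrow> l j (\<tau> v x) = l j (\<tau> v y) \<longleftrightarrow> l j x = l j y"
    and free: "\<lbrakk>x \<in> topspace X; \<tau> v x = \<tau> w x\<rbrakk> \<Longrightarrow> v = w"
begin

text \<open>
  A homeomorphism that moves points along orbits does not increase the mass of clopen sets. Cut
  \<open>A\<close> into the countably many closed pieces \<open>K v\<close> on which \<open>R\<close> agrees
  with \<open>\<tau> v\<close>; freeness makes them disjoint. Enlarge \<open>K v\<close> to a clopen
  \<open>U v\<close> at the cost of a small \<open>\<delta> v\<close>. The sets \<open>\<tau> v ` U
  v\<close> have the same mass as \<open>U v\<close> and cover the compact set \<open>R ` A\<close>, so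
  finitely many suffice, and finite sub- and superadditivity bound the mass of \<open>R ` A\<close> by that
  of \<open>A\<close> up to the sum of the \<open>\<delta> v\<close>.
\<close>
lemma mass_image_le:
  assumes R: "homeomorphic_map X X R" and orbit: "\<And>x. x \<in> topspace X \<Longrightarrow> \<exists>v. R x = \<tau> v x"
    and A: "closedin X A" "openin X A"
  shows "mass (R ` A) \<le> mass A"
proof (rule field_le_epsilon)
  fix e :: real assume e: "0 < e"
  have AX: "A \<subseteq> topspace X" using A closedin_subset by auto
  \<comment> \<open>Weights on the countable index type whose total is at most \<open>e\<close>.\<close>
  define code where "code = to_nat_on (UNIV :: 'v set)"
  have inj_code: "inj code" using count unfolding code_def by (rule inj_on_to_nat_on)
  define \<delta> where "\<delta> v = e * (1/2) ^ Suc (code v)" for v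
  have \<delta>: "0 < \<delta> v" for v using e by (simp add: \<delta>_def)
  have sum_\<delta>: "(\<Sum>v\<in>F. \<delta> v) \<le> e" if "finite F" for F
  proof -
    have "(\<Sum>v\<in>F. (1/2::real) ^ Suc (code v)) = (\<Sum>i\<in>code ` F. (1/2) ^ Suc i)"
      using inj_code by (subst sum.reindex) (auto intro: inj_on_subset)
    also have "\<dots> \<le> (\<Sum>i. (1/2::real) ^ Suc i)"
      using that power_half_series by (intro sum_le_suminf) (auto simp: sums_iff)
    also have "\<dots> = 1" using power_half_series by (simp add: sums_iff)
    finally have "e * (\<Sum>v\<in>F. (1/2::real) ^ Suc (code v)) \<le> e * 1" using e by (intro mult_left_mono) auto
    then show ?thesis by (simp add: \<delta>_def sum_distrib_left)
  qed
  define K where "K v = A \<inter> {x \<in> topspace X. R x = \<tau> v x}" for v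
  have closed_K: "closedin X (K v)" for v
    unfolding K_def
    using A Hausdorff homeomorphic_imp_continuous_map[OF R] homeomorphic_imp_continuous_map[OF \<tau>]
    by (intro closedin_Int closedin_continuous_maps_eq[where Y=X]) auto
  have disjoint_K: "K v \<inter> K w = {}" if "v \<noteq> w" for v w
    using that free unfolding K_def by fastforce
  have "\<forall>v. \<exists>j. ratio j (K v) < mass (K v) + \<delta> v"
    using ratio_approximates_mass[OF \<delta>] by blast
  then obtain k where k: "\<And>v. ratio (k v) (K v) < mass (K v) + \<delta> v" by metis
  define U where "U v = {y \<in> topspace X. \<exists>x\<in>K v. l (k v) y = l (k v) x}" for v
  have KX: "K v \<subseteq> topspace X" for v by (auto simp: K_def)
  have UX: "U v \<subseteq> topspace X" for v by (auto simp: U_def)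
  have "K v \<subseteq> U v" for v using KX by (auto simp: U_def)
  then have labels_U: "l (k v) ` U v = l (k v) ` K v" for v
    by (auto simp: U_def)
  have mapsto: "\<tau> v x \<in> topspace X" if "x \<in> topspace X" for v x
    using homeomorphic_imp_surjective_map[OF \<tau>] that by blast
  have sat: "saturated (k v) (\<tau> v ` U v)" for v
    unfolding saturated_def
  proof (intro conjI ballI impI)
    show "\<tau> v ` U v \<subseteq> topspace X" using mapsto UX by blast
    fix x y assume x: "x \<in> \<tau> v ` U v" and y: "y \<in> topspace X" and eq: "l (k v) y = l (k v) x"
    obtain x' where x': "x' \<in> U v" "x = \<tau> v x'" using x by blast
    obtain y' where y': "y' \<in> topspace X" "y = \<tau> v y'"
      using y homeomorphic_imp_surjective_map[OF \<tau>] by blast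
    have "l (k v) y' = l (k v) x'" using eq x' y' perm UX by blast
    then have "y' \<in> U v" using x' y' by (auto simp: U_def)
    then show "y \<in> \<tau> v ` U v" using y' by blast
  qed
  \<comment> \<open>The action permutes fibres, so \<open>\<tau> v\<close> induces the bijection \<open>h\<close> on labels.\<close>
  have card_image: "card (l (k v) ` \<tau> v ` U v) = card (l (k v) ` U v)" for v
  proof (rule bij_betw_same_card[symmetric])
    define h where "h r = l (k v) (\<tau> v (SOME x. x \<in> U v \<and> l (k v) x = r))" for r
    have h: "h (l (k v) x) = l (k v) (\<tau> v x)" if "x \<in> U v" for x
    proof -
      have "(SOME z. z \<in> U v \<and> l (k v) z = l (k v) x) \<in> U v \<and> l (k v) (SOME z. z \<in> U v \<and> l (k v) z = l (k v) x) = l (k v) x"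
        using that by (intro someI[where P="\<lambda>z. z \<in> U v \<and> l (k v) z = l (k v) x"]) auto
      then show ?thesis unfolding h_def using perm that UX by blast
    qed
    show "bij_betw h (l (k v) ` U v) (l (k v) ` \<tau> v ` U v)"
      unfolding bij_betw_def
    proof
      show "inj_on h (l (k v) ` U v)"
        using h perm UX by (auto intro!: inj_onI) blast
      show "h ` l (k v) ` U v = l (k v) ` \<tau> v ` U v"
        using h by (auto simp: image_iff)
    qed
  qed
  have mass_U: "mass (\<tau> v ` U v) \<le> mass (K v) + \<delta> v" for v
    using mass_le_ratio[of "\<tau> v ` U v" "k v"] k[of v] card_image labels_U
    by (simp add: ratio_def)
  have RA: "closedin X (R ` A)" "openin X (R ` A)"
    using homeomorphic_map_closedness[OF R AX] homeomorphic_map_openness[OF R AX] A by auto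
  then obtain i where i: "saturated i (R ` A)" using clopen_saturated by blast
  obtain i' where i': "saturated i' A" using clopen_saturated A by blast
  have cover: "R ` A \<subseteq> \<Union>(range (\<lambda>v. \<tau> v ` U v))"
  proof
    fix y assume "y \<in> R ` A"
    then obtain x where x: "x \<in> A" "y = R x" by blast
    then obtain v where "R x = \<tau> v x" using orbit AX by blast
    then have "x \<in> U v" using x AX \<open>K v \<subseteq> U v\<close> by (auto simp: K_def)
    then show "y \<in> \<Union>(range (\<lambda>v. \<tau> v ` U v))" using x \<open>R x = \<tau> v x\<close> by auto
  qed
  have "compactin X (R ` A)" using RA compact closedin_compact_space by blast
  then obtain \<F> where \<F>: "finite \<F>" "\<F> \<subseteq> range (\<lambda>v. \<tau> v ` U v)" "R ` A \<subseteq> \<Union>\<F>"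
    using compactinD[OF _ _ cover] saturated_open[OF sat] by (metis (no_types, lifting) rangeE)
  then obtain F where F: "finite F" "\<F> = (\<lambda>v. \<tau> v ` U v) ` F"
    by (meson finite_subset_image)
  have "mass (R ` A) \<le> (\<Sum>v\<in>F. mass (\<tau> v ` U v))"
    using \<F> F by (intro mass_subadditive[OF F(1) sat i]) auto
  also have "\<dots> \<le> (\<Sum>v\<in>F. mass (K v) + \<delta> v)"
    by (intro sum_mono mass_U)
  also have "\<dots> = (\<Sum>v\<in>F. mass (K v)) + (\<Sum>v\<in>F. \<delta> v)" by (rule sum.distrib)
  also have "\<dots> \<le> mass A + e"
    using F(1) closed_K disjoint_K
    by (intro add_mono sum_\<delta> mass_superadditive[OF _ _ _ i']) (auto simp: K_def)
  finally show "mass (R ` A) \<le> mass A + e" .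
qed

text \<open>
  Equality follows by applying the inequality to the complement as well.
\<close>
lemma mass_image_eq:
  assumes R: "homeomorphic_map X X R" and orbit: "\<And>x. x \<in> topspace X \<Longrightarrow> \<exists>v. R x = \<tau> v x"
    and A: "closedin X A" "openin X A"
  shows "mass (R ` A) = mass A"
proof (rule antisym)
  note le = mass_image_le[OF R orbit]
  show "mass (R ` A) \<le> mass A" using le A by blast
  have AX: "A \<subseteq> topspace X" using A closedin_subset by auto
  have RA: "closedin X (R ` A)" "openin X (R ` A)"
    using homeomorphic_map_closedness[OF R AX] homeomorphic_map_openness[OF R AX] A by auto
  have "R ` (topspace X - A) = topspace X - R ` A"
    using homeomorphic_imp_surjective_map[OF R] homeomorphic_imp_injective_map[OF R] AX
    by (metis inj_on_image_set_diff Diff_subset order_refl)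
  then have "mass (topspace X - R ` A) \<le> mass (topspace X - A)"
    using le[of "topspace X - A"] A by (auto intro: closedin_diff openin_diff)
  then show "mass A \<le> mass (R ` A)" using mass_complement A RA by simp
qed

text \<open>
  Orbit equivalent odometers have the same supernatural number. Transport the rotation \<open>f\<close> of
  \<open>Y\<close> to \<open>X\<close>: it moves points along the orbits of \<open>\<tau>\<close>, hence
  preserves mass. As it permutes the preimages \<open>B k r\<close> of the \<open>m k\<close> fibres of
  level \<open>k\<close> cyclically, each has mass \<open>1 / m k\<close>. A clopen set in \<open>X\<close>
  has mass a multiple of some \<open>1 / n j\<close>, which gives the second divisibility, and a
  level-\<open>j\<close> fibre of \<open>X\<close>, of mass \<open>1 / n j\<close>, is a union of sets
  \<open>B k r\<close> for a suitable \<open>k\<close>, which gives the first.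
\<close>
lemma orbit_equivalence_cofinal:
  assumes Y: "cyclic_levels Y m l'"
    and f: "homeomorphic_map Y Y f"
    and rot: "\<And>k y. y \<in> topspace Y \<Longrightarrow> l' k (f y) = (l' k y + 1) mod m k"
    and \<Phi>: "homeomorphic_map X Y \<Phi>"
    and orbit: "\<And>x. x \<in> topspace X \<Longrightarrow> \<exists>v. f (\<Phi> x) = \<Phi> (\<tau> v x)"
  shows "\<exists>k. n j dvd m k" and "\<exists>j. m k dvd n j"
proof -
  interpret Y: cyclic_levels Y m l' by fact
  obtain \<Psi> where maps: "homeomorphic_maps X Y \<Phi> \<Psi>" using \<Phi> homeomorphic_map_maps by blast
  then have \<Psi>: "homeomorphic_map Y X \<Psi>" and \<Psi>\<Phi>: "\<And>x. x \<in> topspace X \<Longrightarrow> \<Psi> (\<Phi> x) = x"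
    and \<Phi>\<Psi>: "\<And>y. y \<in> topspace Y \<Longrightarrow> \<Phi> (\<Psi> y) = y"
    by (auto simp: homeomorphic_maps_map)
  have \<Phi>X: "\<Phi> x \<in> topspace Y" if "x \<in> topspace X" for x
    using homeomorphic_imp_surjective_map[OF \<Phi>] that by blast
  have \<Psi>Y: "\<Psi> y \<in> topspace X" if "y \<in> topspace Y" for y
    using homeomorphic_imp_surjective_map[OF \<Psi>] that by blast
  have fY: "f y \<in> topspace Y" if "y \<in> topspace Y" for y
    using homeomorphic_imp_surjective_map[OF f] that by blast
  have \<tau>X: "\<tau> v x \<in> topspace X" if "x \<in> topspace X" for x v
    using homeomorphic_imp_surjective_map[OF \<tau>] that by blast
  define R where "R = \<Psi> \<circ> f \<circ> \<Phi>"
  have R: "homeomorphic_map X X R"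
    unfolding R_def using \<Phi> f \<Psi> homeomorphic_map_compose by metis
  have R_orbit: "\<exists>v. R x = \<tau> v x" if x: "x \<in> topspace X" for x
  proof -
    obtain v where "f (\<Phi> x) = \<Phi> (\<tau> v x)" using orbit x by blast
    then have "R x = \<tau> v x" using \<Psi>\<Phi> \<tau>X x by (simp add: R_def)
    then show ?thesis by blast
  qed
  define B where "B k r = {x \<in> topspace X. l' k (\<Phi> x) = r}" for k r
  have sat_image: "closedin X {x \<in> topspace X. \<Phi> x \<in> V} \<and> openin X {x \<in> topspace X. \<Phi> x \<in> V}"
    if "Y.saturated k V" for k V
    using closedin_continuous_map_preimage[OF homeomorphic_imp_continuous_map[OF \<Phi>] Y.saturated_closed[OF that]]
      openin_continuous_map_preimage[OF homeomorphic_imp_continuous_map[OF \<Phi>] Y.saturated_open[OF that]]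
    by blast
  have B_clopen: "closedin X (B k r)" "openin X (B k r)" for k r
  proof -
    have "B k r = {x \<in> topspace X. \<Phi> x \<in> {y \<in> topspace Y. l' k y = r}}"
      using \<Phi>X by (auto simp: B_def)
    moreover have "Y.saturated k {y \<in> topspace Y. l' k y = r}" by (auto simp: Y.saturated_def)
    ultimately show "closedin X (B k r)" "openin X (B k r)"
      using sat_image[of k "{y \<in> topspace Y. l' k y = r}"] by simp_all
  qed
  have R_B: "R ` B k r = B k (Suc r)" if r: "Suc r < m k" for k r
  proof
    show "R ` B k r \<subseteq> B k (Suc r)"
      using \<Phi>X fY \<Psi>Y \<Phi>\<Psi> rot r by (auto simp: B_def R_def)
    show "B k (Suc r) \<subseteq> R ` B k r"
    proof
      fix z assume z: "z \<in> B k (Suc r)"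
      then obtain x where x: "x \<in> topspace X" "z = R x"
        using homeomorphic_imp_surjective_map[OF R] by (auto simp: B_def)
      have "(l' k (\<Phi> x) + 1) mod m k = Suc r"
        using z x \<Phi>X fY \<Phi>\<Psi> rot by (auto simp: B_def R_def)
      moreover have "l' k (\<Phi> x) < m k" using Y.label_less \<Phi>X x by blast
      ultimately have "l' k (\<Phi> x) = r"
        by (metis Suc_eq_plus1 Suc_inject Suc_lessI mod_less mod_self nat.distinct(1))
      then show "z \<in> R ` B k r" using x by (auto simp: B_def)
    qed
  qed
  have mass_step: "mass (B k (Suc r)) = mass (B k r)" if "Suc r < m k" for k r
    using mass_image_eq[OF R R_orbit B_clopen, of k r] R_B[OF that] by metis
  have mass_B0: "mass (B k r) = mass (B k 0)" if "r < m k" for k r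
    using that by (induction r) (auto simp: mass_step)
  have mass_union: "mass (\<Union>r\<in>I. B k r) = real (card I) * mass (B k 0)" if "I \<subseteq> {..<m k}" for k I
  proof -
    have "finite I" using that finite_subset by blast
    then have "mass (\<Union>r\<in>I. B k r) = (\<Sum>r\<in>I. mass (B k r))"
      using B_clopen by (intro mass_UN) (auto simp: B_def)
    also have "\<dots> = (\<Sum>r\<in>I. mass (B k 0))" using that mass_B0 by (intro sum.cong) auto
    finally show ?thesis by simp
  qed
  have mass_B: "mass (B k 0) = 1 / m k" for k
  proof -
    have "(\<Union>r\<in>{..<m k}. B k r) = topspace X" using \<Phi>X Y.label_less by (auto simp: B_def)
    moreover have "mass (topspace X) = 1" using mass_complement[of "{}"] mass_saturated[of 0 "{}"]
      by (simp add: saturated_def ratio_def)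
    ultimately show ?thesis using mass_union[of "{..<m k}" k] Y.pos[of k] by (simp add: field_simps)
  qed
  show "\<exists>k. n j dvd m k"
  proof -
    define V where "V = {y \<in> topspace Y. l j (\<Psi> y) = 0}"
    have sat0: "saturated j {x \<in> topspace X. l j x = 0}" by (auto simp: saturated_def)
    have V_eq: "V = {y \<in> topspace Y. \<Psi> y \<in> {x \<in> topspace X. l j x = 0}}"
      using \<Psi>Y by (auto simp: V_def)
    have "closedin Y V" "openin Y V"
      unfolding V_eq
      using closedin_continuous_map_preimage[OF homeomorphic_imp_continuous_map[OF \<Psi>] saturated_closed[OF sat0]]
        openin_continuous_map_preimage[OF homeomorphic_imp_continuous_map[OF \<Psi>] saturated_open[OF sat0]]
      by blast+
    then obtain k where k: "Y.saturated k V" using Y.clopen_saturated by blast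
    have "(\<Union>r\<in>l' k ` V. B k r) = {x \<in> topspace X. l j x = 0}"
    proof
      show "(\<Union>r\<in>l' k ` V. B k r) \<subseteq> {x \<in> topspace X. l j x = 0}"
      proof
        fix x assume "x \<in> (\<Union>r\<in>l' k ` V. B k r)"
        then obtain y where y: "y \<in> V" "x \<in> topspace X" "l' k (\<Phi> x) = l' k y" by (auto simp: B_def)
        then have "\<Phi> x \<in> V" using k \<Phi>X unfolding Y.saturated_def by blast
        then show "x \<in> {x \<in> topspace X. l j x = 0}" using y \<Psi>\<Phi> by (auto simp: V_def)
      qed
      show "{x \<in> topspace X. l j x = 0} \<subseteq> (\<Union>r\<in>l' k ` V. B k r)"
      proof
        fix x assume x: "x \<in> {x \<in> topspace X. l j x = 0}"
        then have "\<Phi> x \<in> V" using \<Phi>X \<Psi>\<Phi> by (simp add: V_def)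
        then show "x \<in> (\<Union>r\<in>l' k ` V. B k r)" using x by (auto simp: B_def)
      qed
    qed
    moreover have "l' k ` V \<subseteq> {..<m k}" using Y.label_less by (auto simp: V_def)
    ultimately have "1 / n j = real (card (l' k ` V)) / m k"
      using mass_union[of "l' k ` V" k] mass_fibre[of 0 j] pos[of j] mass_B[of k] by simp
    then have "real (m k) = real (n j * card (l' k ` V))"
      using pos[of j] Y.pos[of k] by (simp add: field_simps)
    then have "m k = n j * card (l' k ` V)" by (simp only: of_nat_eq_iff)
    then show ?thesis by (metis dvd_triv_left)
  qed
  show "\<exists>j. m k dvd n j"
  proof -
    obtain j where j: "saturated j (B k 0)"
      using clopen_saturated[OF B_clopen[of k 0]] by blast
    have "1 / m k = real (card (l j ` B k 0)) / n j"
      using mass_B[of k] mass_saturated[OF j] by (simp add: ratio_def)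
    then have "real (n j) = real (m k * card (l j ` B k 0))"
      using pos[of j] Y.pos[of k] by (simp add: field_simps)
    then have "n j = m k * card (l j ` B k 0)" by (simp only: of_nat_eq_iff)
    then show ?thesis by (metis dvd_triv_left)
  qed
qed

end

section \<open>Finite-index subgroups and the cosets seen by an odometer\<close>

lemma subgroup_diff: "zd_subgroup G \<Longrightarrow> v \<in> G \<Longrightarrow> w \<in> G \<Longrightarrow> v - w \<in> G"
  unfolding zd_subgroup_def by (metis diff_conv_add_uminus)

lemma subgroup_diff_commute: "zd_subgroup G \<Longrightarrow> v - w \<in> G \<longleftrightarrow> w - v \<in> G"
  unfolding zd_subgroup_def by (metis minus_diff_eq)

lemma coset_eq_iff:
  assumes "zd_subgroup G"
  shows "u +o G = v +o G \<longleftrightarrow> u - v \<in> G"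
proof
  assume "u +o G = v +o G"
  moreover have "u \<in> u +o G" using assms by (force simp: elt_set_plus_def zd_subgroup_def)
  ultimately show "u - v \<in> G" by (auto simp: elt_set_plus_def)
next
  have *: "u +o G \<subseteq> v +o G" if "u - v \<in> G" for u v :: "int ^ 'a"
  proof
    fix x assume "x \<in> u +o G"
    then obtain g where g: "g \<in> G" "x = u + g" by (auto simp: elt_set_plus_def)
    then have "(u - v) + g \<in> G" using that assms by (auto simp: zd_subgroup_def)
    then show "x \<in> v +o G" using g by (force simp: elt_set_plus_def)
  qed
  assume "u - v \<in> G"
  then show "u +o G = v +o G" using * subgroup_diff_commute[OF assms, of u v] by blast
qed

lemma subgroup_scale:
  assumes "zd_subgroup G" "v \<in> G"
  shows "a *s v \<in> G"
proof -
  have nat: "int k *s v \<in> G" for k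
  proof (induction k)
    case 0
    have "int 0 *s v = 0" by (simp add: vec_eq_iff)
    then show ?case using assms by (simp add: zd_subgroup_def)
  next
    case (Suc k)
    have "int (Suc k) *s v = int k *s v + v" by (simp add: vec_eq_iff algebra_simps)
    then show ?case using Suc assms by (simp add: zd_subgroup_def)
  qed
  show ?thesis
  proof (cases "0 \<le> a")
    case True
    then show ?thesis using nat[of "nat a"] by simp
  next
    case False
    then have "a *s v = - (int (nat (- a)) *s v)" by (simp add: vec_eq_iff)
    then show ?thesis using nat[of "nat (- a)"] assms unfolding zd_subgroup_def by metis
  qed
qed

text \<open>
  By the pigeonhole principle some positive multiple of \<open>v\<close>, with factor at most the index,
  lies in \<open>G\<close>; the factorial of the index is a multiple of all these factors.
\<close>
lemma finite_index_exponent: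
  fixes G :: "(int ^ 'd) set"
  assumes G: "zd_subgroup G" "finite (zd_quotient G)"
  obtains N :: nat where "0 < N" "\<And>v. int N *s v \<in> G"
proof
  let ?M = "card (zd_quotient G)"
  show "0 < (fact ?M :: nat)" by simp
  show "int (fact ?M) *s v \<in> G" for v
  proof -
    let ?f = "\<lambda>a. (int a *s v) +o G"
    have "\<not> inj_on ?f {..?M}"
    proof
      assume "inj_on ?f {..?M}"
      then have "card {..?M} \<le> ?M"
        using G(2) by (intro card_inj_on_le) (auto simp: zd_quotient_def)
      then show False by simp
    qed
    then obtain a b where ab: "a < b" "b \<le> ?M" "?f a = ?f b"
      unfolding inj_on_def by (metis atMost_iff linorder_neqE_nat)
    then have "int a *s v - int b *s v \<in> G" using coset_eq_iff[OF G(1)] by blast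
    moreover have "int a *s v - int b *s v = - (int (b - a) *s v)"
      using ab by (simp add: vec_eq_iff of_nat_diff algebra_simps)
    ultimately have ba: "int (b - a) *s v \<in> G"
      using G(1) unfolding zd_subgroup_def by (metis minus_minus)
    have "b - a dvd fact ?M" using ab by (intro dvd_fact) auto
    then obtain q where q: "fact ?M = (b - a) * q" by blast
    have "int (fact ?M) *s v = int q *s (int (b - a) *s v)"
      by (simp only: q vector_smult_assoc of_nat_mult mult.commute)
    then show ?thesis using subgroup_scale[OF G(1) ba] by simp
  qed
qed

lemma countable_int_vectors: "countable (UNIV :: (int ^ 'd) set)"
proof -
  have "countable {v :: int ^ 'd. \<forall>i. v $ i \<in> UNIV}"
    by (rule countable_vector) auto
  then show ?thesis by simp
qed

lemma free_action_cancel: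
  assumes T: "zd_action X T" "free_action X T" and x: "x \<in> topspace X" and eq: "T v x = T w x"
  shows "v = w"
proof -
  have "T (- w + v) x = T (- w + w) x" using T x eq unfolding zd_action_def by metis
  then have "T (- w + v) x = x" using T x unfolding zd_action_def by simp
  then have "- w + v = 0" using T x unfolding free_action_def by blast
  then show ?thesis by simp
qed
text \<open>
  An odometer seen through its finite quotients: \<open>c j x\<close> is the coordinate of \<open>x\<close>
  in \<open>\<int>\<^sup>d / G j\<close>, a coset, and \<open>b\<close> is the point that corresponds to the
  identity of the inverse limit. Working with \<open>c\<close> on an arbitrary space avoids carrying the
  conjugacy to the inverse limit through every argument.
\<close>
locale odometer_levels =
  fixes X :: "'a topology" and T :: "int ^ 'd \<Rightarrow> 'a \<Rightarrow> 'a" and G :: "nat \<Rightarrow> (int ^ 'd) set"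
    and c :: "nat \<Rightarrow> 'a \<Rightarrow> (int ^ 'd) set" and b :: 'a
  assumes subgroup: "zd_subgroup (G j)"
    and finite_index: "finite (zd_quotient (G j))"
    and G_Suc: "G (Suc j) \<subseteq> G j"
    and compact: "compact_space X"
    and action: "zd_action X T"
    and coset: "x \<in> topspace X \<Longrightarrow> c j x \<in> zd_quotient (G j)"
    and coset_translate: "x \<in> topspace X \<Longrightarrow> c j (T v x) = v +o c j x"
    and coset_Suc: "x \<in> topspace X \<Longrightarrow> c (Suc j) x \<subseteq> c j x"
    and open_coset: "openin X {x \<in> topspace X. c j x = q}"
    and separating: "\<lbrakk>x \<in> topspace X; y \<in> topspace X; \<And>j. c j x = c j y\<rbrakk> \<Longrightarrow> x = y"
    and base: "b \<in> topspace X" "c j b = G j"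
begin

lemma T_homeomorphic: "homeomorphic_map X X (T v)"
  using action by (simp add: zd_action_def)

lemma T_in: "x \<in> topspace X \<Longrightarrow> T v x \<in> topspace X"
  using homeomorphic_imp_surjective_map[OF T_homeomorphic] by blast

lemma G_antimono: "i \<le> j \<Longrightarrow> G j \<subseteq> G i"
  by (rule lift_Suc_antimono_le[of G, OF G_Suc])

lemma coset_eq_iff_mem:
  assumes "x \<in> topspace X"
  shows "c j x = u +o G j \<longleftrightarrow> u \<in> c j x"
proof -
  obtain v where v: "c j x = v +o G j" using coset[OF assms] by (auto simp: zd_quotient_def)
  have "u \<in> c j x \<longleftrightarrow> u - v \<in> G j" unfolding v elt_set_plus_def by force
  then show ?thesis using v coset_eq_iff[OF subgroup, of v j u] subgroup_diff_commute[OF subgroup] by metis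
qed

lemma coset_antimono: "i \<le> j \<Longrightarrow> x \<in> topspace X \<Longrightarrow> c j x \<subseteq> c i x"
  using lift_Suc_antimono_le[of "\<lambda>j. c j x"] coset_Suc by blast

lemma coset_lower:
  assumes "i \<le> j" "x \<in> topspace X" "c j x = u +o G j"
  shows "c i x = u +o G i"
  using assms coset_eq_iff_mem coset_antimono by blast

lemma coset_eq_lower:
  assumes "i \<le> j" "x \<in> topspace X" "y \<in> topspace X" "c j x = c j y"
  shows "c i x = c i y"
proof -
  obtain u where "c j x = u +o G j" using coset[OF assms(2)] by (auto simp: zd_quotient_def)
  then show ?thesis using coset_lower assms by metis
qed

lemma coset_translate_eq:
  "x \<in> topspace X \<Longrightarrow> c j x = u +o G j \<Longrightarrow> c j (T v x) = (v + u) +o G j"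
  by (simp add: coset_translate set_plus_rearrange2)

text \<open>
  An element of all \<open>G j\<close> would fix every coordinate, hence fix \<open>b\<close>.
\<close>
lemma trivial_intersection:
  assumes "free_action X T" "u \<noteq> 0"
  shows "\<exists>j. u \<notin> G j"
proof (rule ccontr)
  assume "\<not> ?thesis"
  then have u: "u \<in> G j" for j by blast
  have "c j b = 0 +o G j" for j by (simp add: base)
  then have "c j (T u b) = u +o G j" for j using coset_translate_eq[OF base(1), of j 0 u] by simp
  moreover have "u +o G j = c j b" for j
    using u coset_eq_iff_mem[OF base(1)] base(2) by blast
  ultimately have "T u b = b" using T_in base by (intro separating) auto
  then show False using assms base unfolding free_action_def by blast
qed

end

text \<open>
  A way to turn cosets into cyclic labels: at level \<open>j\<close>, the vectors \<open>w j i\<close> for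
  \<open>i < n j\<close> represent the cosets of \<open>G (k j)\<close>, and representatives at successive
  levels agree modulo the coarser subgroup. The index \<open>k j\<close> allows levels of the odometer to be
  skipped.
\<close>
locale odometer_numbering = odometer_levels X T G c b
  for X :: "'a topology" and T :: "int ^ 'd \<Rightarrow> 'a \<Rightarrow> 'a" and G :: "nat \<Rightarrow> (int ^ 'd) set"
    and c :: "nat \<Rightarrow> 'a \<Rightarrow> (int ^ 'd) set" and b :: 'a +
  fixes k n :: "nat \<Rightarrow> nat" and w :: "nat \<Rightarrow> nat \<Rightarrow> int ^ 'd"
  assumes k_ge: "j \<le> k j" and k_Suc: "k j \<le> k (Suc j)"
    and n_pos: "0 < n j"
    and w_inj: "w j i - w j i' \<in> G (k j) \<longleftrightarrow> i mod n j = i' mod n j"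
    and w_surj: "\<exists>i. u - w j i \<in> G (k j)"
    and w_Suc: "w (Suc j) i - w j i \<in> G (k j)"
begin

definition number :: "nat \<Rightarrow> 'a \<Rightarrow> nat" where
  "number j x = (SOME i. c (k j) x = w j i +o G (k j)) mod n j"

lemma number_less: "number j x < n j"
  using n_pos by (simp add: number_def)

lemma number_eqI:
  assumes "c (k j) x = w j i +o G (k j)"
  shows "number j x = i mod n j"
proof -
  have "c (k j) x = w j (SOME i. c (k j) x = w j i +o G (k j)) +o G (k j)"
    using assms by (rule someI)
  then show ?thesis
    unfolding number_def using assms w_inj coset_eq_iff[OF subgroup] by metis
qed

lemma coset_number:
  assumes "x \<in> topspace X"
  shows "c (k j) x = w j (number j x) +o G (k j)"
proof -
  obtain u where u: "c (k j) x = u +o G (k j)" using coset[OF assms] by (auto simp: zd_quotient_def)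
  obtain i where "u - w j i \<in> G (k j)" using w_surj by blast
  then have i: "c (k j) x = w j i +o G (k j)" using u coset_eq_iff[OF subgroup] by blast
  have "w j i +o G (k j) = w j (number j x) +o G (k j)"
    using number_eqI[OF i] w_inj by (simp add: coset_eq_iff[OF subgroup])
  then show ?thesis using i by simp
qed

lemma number_eq_iff:
  assumes "x \<in> topspace X" "y \<in> topspace X"
  shows "number j x = number j y \<longleftrightarrow> c (k j) x = c (k j) y"
  using coset_number assms number_def by metis

lemma cyclic: "cyclic_levels X n number"
proof
  show "n j dvd n (Suc j)" for j
  proof -
    have *: "w (Suc j) (n (Suc j)) - w (Suc j) 0 \<in> G (k j)"
      using w_inj[of "Suc j"] G_antimono[OF k_Suc] by (metis mod_self mod_0 subsetD)
    have "(w (Suc j) (n (Suc j)) - w (Suc j) 0) - (w (Suc j) (n (Suc j)) - w j (n (Suc j)))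
        + (w (Suc j) 0 - w j 0) \<in> G (k j)"
      using subgroup_diff[OF subgroup * w_Suc] w_Suc subgroup[of "k j"]
      unfolding zd_subgroup_def by blast
    then have "w j (n (Suc j)) - w j 0 \<in> G (k j)" by simp
    then show ?thesis using w_inj[of j] by (simp add: mod_eq_0_iff_dvd)
  qed
  show "number (Suc j) x mod n j = number j x" if x: "x \<in> topspace X" for x j
  proof -
    have "c (k j) x = w (Suc j) (number (Suc j) x) +o G (k j)"
      using coset_lower[OF k_Suc x coset_number[OF x]] .
    also have "\<dots> = w j (number (Suc j) x) +o G (k j)"
      using w_Suc by (simp add: coset_eq_iff[OF subgroup])
    finally show ?thesis using number_eqI by simp
  qed
  show "\<exists>x\<in>topspace X. number j x = r" if "r < n j" for r j
  proof
    show "T (w j r) b \<in> topspace X" using T_in base by blast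
    have "c (k j) (T (w j r) b) = w j r +o G (k j)"
      using coset_translate base by simp
    then show "number j (T (w j r) b) = r" using number_eqI that by fastforce
  qed
  show "openin X {x \<in> topspace X. number j x = r}" for j r
  proof (cases "r < n j")
    case True
    have "number j x = r \<longleftrightarrow> c (k j) x = w j r +o G (k j)" if "x \<in> topspace X" for x
      using coset_number[OF that, of j] number_eqI[of j x r] True by auto
    then have "{x \<in> topspace X. number j x = r} = {x \<in> topspace X. c (k j) x = w j r +o G (k j)}"
      by blast
    then show ?thesis using open_coset by simp
  next
    case False
    then have "{x \<in> topspace X. number j x = r} = {}" using number_less by auto
    then show ?thesis by (metis openin_empty)
  qed
  show "x = y" if xy: "x \<in> topspace X" "y \<in> topspace X" and "\<And>j. number j x = number j y" for x y
  proof (rule separating[OF xy])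
    show "c j x = c j y" for j
      using coset_eq_lower[OF k_ge xy] number_eq_iff[OF xy] that by blast
  qed
qed (use compact n_pos number_less in auto)

lemma number_translate_iff:
  assumes "x \<in> topspace X" "y \<in> topspace X"
  shows "number j (T v x) = number j (T v y) \<longleftrightarrow> number j x = number j y"
proof -
  have "v +o A = v +o B \<longleftrightarrow> A = B" for A B :: "(int ^ 'd) set"
  proof -
    have "- v +o (v +o A) = A" for A :: "(int ^ 'd) set" by (simp add: set_plus_rearrange2)
    then show ?thesis by metis
  qed
  then show ?thesis using number_eq_iff assms T_in coset_translate by simp
qed

end

text \<open>
  The modulus \<open>m\<close> is the least positive element.
\<close>
lemma subgroup_of_int1:
  fixes H :: "(int ^ 1) set"
  assumes H: "zd_subgroup H" "finite (zd_quotient H)"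
  obtains m :: nat where "0 < m" "\<And>i. vec i \<in> H \<longleftrightarrow> int m dvd i"
proof -
  obtain N :: nat where N: "0 < N" "\<And>v. int N *s v \<in> H" using finite_index_exponent[OF H] by blast
  have scale: "a *s (vec i :: int ^ 1) = vec (a * i)" for a i by (simp add: vec_eq_iff)
  define P where "P m \<longleftrightarrow> 0 < m \<and> vec (int m) \<in> H" for m
  define m where "m = (LEAST m. P m)"
  have "P N" using N(1) N(2)[of "vec 1"] unfolding P_def scale by simp
  then have m: "P m" unfolding m_def by (rule LeastI)
  have "vec i \<in> H \<longleftrightarrow> int m dvd i" for i
  proof
    assume i: "vec i \<in> H"
    have "(i div int m) *s vec (int m) \<in> H" using subgroup_scale H m by (auto simp: P_def)
    then have "vec i - vec (i div int m * int m) \<in> H" using subgroup_diff[OF H(1) i] by (simp add: scale)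
    moreover have "vec i - vec (i div int m * int m) = (vec (i mod int m) :: int ^ 1)"
      by (simp add: vec_eq_iff minus_div_mult_eq_mod)
    ultimately have "vec (int (nat (i mod int m))) \<in> H" using m by (simp add: P_def)
    moreover have "nat (i mod int m) < m" using m by (simp add: P_def nat_less_iff)
    ultimately have "nat (i mod int m) = 0"
      using not_less_Least[of "nat (i mod int m)" P, folded m_def] unfolding P_def by simp
    then have "i mod int m \<le> 0" by simp
    moreover have "0 \<le> i mod int m" using m by (simp add: P_def)
    ultimately have "i mod int m = 0" by (rule antisym)
    then show "int m dvd i" by (rule mod_0_imp_dvd)
  next
    assume "int m dvd i"
    then obtain a where a: "i = a * int m" by (metis dvd_def mult.commute)
    have "a *s vec (int m) \<in> H" using subgroup_scale H m by (auto simp: P_def)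
    then show "vec i \<in> H" by (simp add: scale a)
  qed
  then show ?thesis using that m by (auto simp: P_def)
qed

text \<open>
  For a \<open>\<int>\<close>-odometer the vectors \<open>0, 1, 2, \<dots>\<close> represent the cosets, and
  the generator adds one.
\<close>
lemma Z_odometer_cyclic:
  fixes T :: "int ^ 1 \<Rightarrow> 'a \<Rightarrow> 'a"
  assumes "odometer_levels X T G c b"
  obtains m l where "cyclic_levels X m l"
    "\<And>j x. x \<in> topspace X \<Longrightarrow> l j (T (vec 1) x) = (l j x + 1) mod m j"
proof -
  interpret odometer_levels X T G c b by fact
  have "\<exists>m. 0 < m \<and> (\<forall>i. vec i \<in> G j \<longleftrightarrow> int m dvd i)" for j
    by (rule subgroup_of_int1[OF subgroup finite_index, of j]) blast
  then obtain m where "\<forall>j. 0 < m j \<and> (\<forall>i. vec i \<in> G j \<longleftrightarrow> int (m j) dvd i)"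
    using choice[of "\<lambda>j m. 0 < m \<and> (\<forall>i. vec i \<in> G j \<longleftrightarrow> int m dvd i)"] by blast
  then have m: "\<And>j. 0 < m j" "\<And>j i. vec i \<in> G j \<longleftrightarrow> int (m j) dvd i" by auto
  have vec_diff: "vec i - vec i' = (vec (i - i') :: int ^ 1)" for i i' :: int by (simp add: vec_eq_iff)
  interpret odometer_numbering X T G c b id m "\<lambda>j i. vec (int i)"
  proof
    show "vec (int i) - vec (int i') \<in> G (id j) \<longleftrightarrow> i mod m j = i' mod m j" for j i i'
    proof -
      have "vec (int i) - vec (int i') \<in> G (id j) \<longleftrightarrow> int (m j) dvd int i - int i'"
        by (simp add: vec_diff m)
      also have "\<dots> \<longleftrightarrow> int i mod int (m j) = int i' mod int (m j)" by (metis mod_eq_dvd_iff)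
      finally show ?thesis by (metis of_nat_eq_iff zmod_int)
    qed
    show "\<exists>i. u - vec (int i) \<in> G (id j)" for u j
    proof
      have "u - vec (int (nat (u $ 1 mod int (m j)))) = vec (u $ 1 - u $ 1 mod int (m j))"
        using m(1)[of j] by (simp add: vec_eq_iff)
      then show "u - vec (int (nat (u $ 1 mod int (m j)))) \<in> G (id j)"
        by (simp add: m)
    qed
    show "vec (int i) - vec (int i) \<in> G (id j)" for i j
      using subgroup[of j] by (simp add: zd_subgroup_def)
  qed (use m in auto)
  have "number j (T (vec 1) x) = (number j x + 1) mod m j" if x: "x \<in> topspace X" for j x
  proof (rule number_eqI)
    have "vec 1 + vec (int (number j x)) = (vec (int (number j x + 1)) :: int ^ 1)"
      by (simp add: vec_eq_iff)
    then show "c (id j) (T (vec 1) x) = vec (int (number j x + 1)) +o G (id j)"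
      using coset_translate_eq[OF x coset_number[OF x, of j], of "vec 1"] by simp
  qed
  then show ?thesis using that cyclic by blast
qed

text \<open>
  The inverse limit is compact because each compatibility condition is a closed condition on the product of
  finite discrete spaces.
\<close>
lemma odometer_imp_levels:
  fixes T :: "int ^ 'd \<Rightarrow> 'a \<Rightarrow> 'a"
  assumes "odometer X T"
  obtains G c b where "odometer_levels X T G c b"
proof -
  obtain G where act: "zd_action X T" and G: "decreasing_finite_index G"
    and "conjugate_actions X T (odometer_space G) odometer_action"
    using assms by (auto simp: odometer_def)
  then obtain \<Psi> where \<Psi>: "homeomorphic_map X (odometer_space G) \<Psi>"
    and equiv: "\<And>v x. x \<in> topspace X \<Longrightarrow> \<Psi> (T v x) = odometer_action v (\<Psi> x)"
    unfolding conjugate_actions_def by blast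
  have sub: "zd_subgroup (G j)" and fin: "finite (zd_quotient (G j))" and dec: "G (Suc j) \<subseteq> G j" for j
    using G by (auto simp: decreasing_finite_index_def)
  let ?P = "product_topology (\<lambda>j. discrete_topology (zd_quotient (G j))) UNIV"
  have top: "topspace (odometer_space G) = {x. (\<forall>j. x j \<in> zd_quotient (G j)) \<and> (\<forall>j. x (Suc j) + G j = x j)}"
    by (auto simp: odometer_space_def PiE_def Pi_def)
  have coord: "continuous_map ?P (discrete_topology (zd_quotient (G j))) (\<lambda>x. x j)" for j
    by (rule continuous_map_product_projection) simp
  have GG: "G (Suc j) + G j = G j" for j
  proof
    show "G (Suc j) + G j \<subseteq> G j"
    proof
      fix x assume "x \<in> G (Suc j) + G j"
      then obtain g h where "g \<in> G (Suc j)" "h \<in> G j" "x = g + h" by (auto simp: set_plus_def)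
      then show "x \<in> G j" using dec[of j] sub[of j] unfolding zd_subgroup_def by blast
    qed
    show "G j \<subseteq> G (Suc j) + G j"
      using sub[of "Suc j"] by (force simp: set_plus_def zd_subgroup_def)
  qed
  have proj: "q + G j \<in> zd_quotient (G j)" if q: "q \<in> zd_quotient (G (Suc j))" for q j
  proof -
    obtain v where v: "q = v +o G (Suc j)" using q by (auto simp: zd_quotient_def)
    then have "q + G j = v +o G j" using GG by (simp add: set_plus_rearrange3)
    then show ?thesis by (auto simp: zd_quotient_def)
  qed
  have "closedin ?P {x \<in> topspace ?P. x (Suc j) + G j = x j}" for j
  proof (rule closedin_continuous_maps_eq[where Y="discrete_topology (zd_quotient (G j))"])
    have "continuous_map ?P (discrete_topology (zd_quotient (G j))) ((\<lambda>q. q + G j) \<circ> (\<lambda>x. x (Suc j)))"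
      using proj by (intro continuous_map_compose[OF coord]) (auto simp: continuous_map_from_discrete_topology)
    then show "continuous_map ?P (discrete_topology (zd_quotient (G j))) (\<lambda>x. x (Suc j) + G j)"
      by (simp add: o_def)
  qed (auto intro: coord)
  then have "closedin ?P (\<Inter>j. {x \<in> topspace ?P. x (Suc j) + G j = x j})"
    by (intro closedin_Inter) auto
  moreover have "compact_space ?P"
    using fin by (simp add: compact_space_product_topology compact_space_discrete_topology)
  ultimately have "compact_space (subtopology ?P (\<Inter>j. {x \<in> topspace ?P. x (Suc j) + G j = x j}))"
    by (simp add: closedin_compact_space compact_space_subtopology)
  moreover have "subtopology ?P (\<Inter>j. {x \<in> topspace ?P. x (Suc j) + G j = x j}) = odometer_space G"
    unfolding odometer_space_def
  proof -
    have "(\<Inter>j. {x \<in> topspace ?P. x (Suc j) + G j = x j}) = topspace ?P \<inter> {x. \<forall>j. x (Suc j) + G j = x j}"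
      by auto
    then show "subtopology ?P (\<Inter>j. {x \<in> topspace ?P. x (Suc j) + G j = x j}) = subtopology ?P {x. \<forall>j. x (Suc j) + G j = x j}"
      by (metis subtopology_restrict)
  qed
  ultimately have compact_odo: "compact_space (odometer_space G)" by simp
  have compact: "compact_space X"
    using compact_odo homeomorphic_compact_space homeomorphic_map_imp_homeomorphic_space[OF \<Psi>] by blast
  have \<Psi>_in: "\<Psi> x \<in> topspace (odometer_space G)" if "x \<in> topspace X" for x
    using homeomorphic_imp_surjective_map[OF \<Psi>] that by blast
  have "G j = 0 +o G j" for j by simp
  then have "G \<in> topspace (odometer_space G)"
    unfolding top zd_quotient_def using GG by blast
  then obtain b where b: "b \<in> topspace X" "\<Psi> b = G"
    using homeomorphic_imp_surjective_map[OF \<Psi>] by (metis imageE)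
  have "odometer_levels X T G (\<lambda>j x. \<Psi> x j) b"
  proof
    show "\<Psi> x j \<in> zd_quotient (G j)" if "x \<in> topspace X" for x j
      using \<Psi>_in[OF that] by (simp add: top)
    show "\<Psi> (T v x) j = v +o \<Psi> x j" if "x \<in> topspace X" for x j v
      using equiv that by (simp add: odometer_action_def)
    show "\<Psi> x (Suc j) \<subseteq> \<Psi> x j" if "x \<in> topspace X" for x j
    proof -
      have "\<Psi> x (Suc j) + G j = \<Psi> x j" using \<Psi>_in[OF that] by (simp add: top)
      moreover have "A \<subseteq> A + G j" for A
        using sub[of j] by (force simp: set_plus_def zd_subgroup_def)
      ultimately show ?thesis by metis
    qed
    show "openin X {x \<in> topspace X. \<Psi> x j = q}" for j q
    proof -
      have "continuous_map X (discrete_topology (zd_quotient (G j))) ((\<lambda>x. x j) \<circ> \<Psi>)"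
        using coord homeomorphic_imp_continuous_map[OF \<Psi>] unfolding odometer_space_def
        by (intro continuous_map_compose[of _ "odometer_space G"])
          (auto simp: odometer_space_def intro: continuous_map_from_subtopology)
      then have "openin X {x \<in> topspace X. ((\<lambda>x. x j) \<circ> \<Psi>) x \<in> {q} \<inter> zd_quotient (G j)}"
        by (rule openin_continuous_map_preimage) auto
      moreover have "{x \<in> topspace X. ((\<lambda>x. x j) \<circ> \<Psi>) x \<in> {q} \<inter> zd_quotient (G j)} = {x \<in> topspace X. \<Psi> x j = q}"
        using \<Psi>_in by (auto simp: top)
      ultimately show ?thesis by simp
    qed
    show "x = y" if "x \<in> topspace X" "y \<in> topspace X" "\<And>j. \<Psi> x j = \<Psi> y j" for x y
      using homeomorphic_imp_injective_map[OF \<Psi>] that by (metis ext inj_onD)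
  qed (use sub fin dec compact act b in auto)
  then show ?thesis using that by blast
qed

section \<open>Cones meet every coset\<close>

text \<open>
  A filled cone contains the open cone over some ball. It is open and nonempty, so it contains a ball that
  avoids its finitely many hyperplanes. An open ray from the origin through that ball never meets a
  hyperplane through the origin, so it never meets the boundary of the cone; being connected, it stays
  inside.
\<close>
lemma filled_cone_contains_open_rays:
  fixes F :: "(real ^ 'd) set"
  assumes "filled_cone F"
  obtains x0 r where "0 < r" "0 \<notin> ball x0 r" "\<And>y t. \<lbrakk>y \<in> ball x0 r; 0 < t\<rbrakk> \<Longrightarrow> t *\<^sub>R y \<in> F"
proof -
  obtain \<H> where F: "open F" "connected F" and card: "card \<H> = CARD('d)"
    and hyp: "\<And>H. H \<in> \<H> \<Longrightarrow> \<exists>a. a \<noteq> 0 \<and> H = {x. a \<bullet> x = 0}"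
    and front: "frontier F \<subseteq> \<Union>\<H>"
    and portion: "\<And>H. H \<in> \<H> \<Longrightarrow> \<exists>U. open U \<and> U \<inter> H \<noteq> {} \<and> U \<inter> H \<subseteq> frontier F"
    using assms unfolding filled_cone_def by metis
  have fin: "finite \<H>" and ne: "\<H> \<noteq> {}" using card card_eq_0_iff[of \<H>] by auto
  then obtain H0 where H0: "H0 \<in> \<H>" by blast
  then have "F \<noteq> {}" using portion[OF H0] by auto
  have neg: "negligible (\<Union>\<H>)"
  proof (rule negligible_Union[OF fin])
    show "negligible H" if H: "H \<in> \<H>" for H
    proof -
      obtain a where "a \<noteq> 0" "H = {x. a \<bullet> x = 0}" using hyp[OF H] by blast
      then show ?thesis using negligible_hyperplane[of a 0] by simp
    qed
  qed
  have "closed H" if "H \<in> \<H>" for H using hyp[OF that] closed_hyperplane by auto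
  then have "closed (\<Union>\<H>)" using fin by (intro closed_Union) auto
  then have "open (F - \<Union>\<H>)" using F by (intro open_Diff) auto
  moreover have "F - \<Union>\<H> \<noteq> {}"
    using open_not_negligible[OF F(1) \<open>F \<noteq> {}\<close>] negligible_subset[OF neg] by blast
  ultimately obtain x0 r where r: "0 < r" "ball x0 r \<subseteq> F - \<Union>\<H>"
    unfolding open_contains_ball by blast
  have scale: "t *\<^sub>R y \<in> \<Union>\<H> \<longleftrightarrow> y \<in> \<Union>\<H>" if "0 < t" for t y
  proof -
    have "t *\<^sub>R y \<in> H \<longleftrightarrow> y \<in> H" if "H \<in> \<H>" for H
      using hyp[OF that] \<open>0 < t\<close> by auto
    then show ?thesis by blast
  qed
  have "t *\<^sub>R y \<in> F" if y: "y \<in> ball x0 r" and t: "0 < t" for y t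
  proof (rule ccontr)
    assume "t *\<^sub>R y \<notin> F"
    let ?R = "(\<lambda>s. s *\<^sub>R y) ` {0<..}"
    have "connected ?R"
      by (intro connected_continuous_image continuous_intros) auto
    moreover have "y \<in> ?R \<inter> F" using r y by (auto intro!: image_eqI[of _ _ 1])
    moreover have "t *\<^sub>R y \<in> ?R - F" using t \<open>t *\<^sub>R y \<notin> F\<close> by auto
    ultimately obtain z where "z \<in> ?R" "z \<in> frontier F"
      using connected_Int_frontier[of ?R F] by blast
    then obtain s where "0 < s" "s *\<^sub>R y \<in> \<Union>\<H>" using front by blast
    then have "y \<in> \<Union>\<H>" using scale by blast
    then show False using r y by blast
  qed
  moreover have "0 \<notin> ball x0 r"
  proof
    assume "0 \<in> ball x0 r"
    then have "0 \<notin> H0" using r H0 by blast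
    then show False using hyp[OF H0] by auto
  qed
  ultimately show ?thesis using that r(1) by blast
qed

text \<open>
  If \<open>N\<close> kills the quotient by \<open>G\<close>, then \<open>u + N \<int>\<^sup>d\<close> lies
  in the coset of \<open>u\<close> and is a lattice with cells of side \<open>N\<close>, so it meets every
  large enough ball, and an open cone contains balls of any size.
\<close>
lemma cone_meets_coset:
  fixes C :: "(int ^ 'd) set"
  assumes C: "zd_cone C" and G: "zd_subgroup G" "finite (zd_quotient G)"
  shows "\<exists>w\<in>C. w - u \<in> G"
proof -
  obtain F where F: "filled_cone F" "C = {v. v \<noteq> 0 \<and> real_vec v \<in> F}"
    using C by (auto simp: zd_cone_def)
  obtain x0 r where r: "0 < r" "0 \<notin> ball x0 r"
    and rays: "\<And>y t. \<lbrakk>y \<in> ball x0 r; 0 < t\<rbrakk> \<Longrightarrow> t *\<^sub>R y \<in> F"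
    using filled_cone_contains_open_rays[OF F(1)] by metis
  obtain N :: nat where N: "0 < N" "\<And>v. int N *s v \<in> G"
    using finite_index_exponent[OF G] by blast
  \<comment> \<open>At this scale the ball of radius \<open>t * r\<close> is larger than the diameter of a lattice cell.\<close>
  define t where "t = (real CARD('d) * real N + 1) / r"
  have t: "0 < t" using r by (simp add: t_def add_nonneg_pos)
  define z :: "int ^ 'd" where "z = (\<chi> i. \<lfloor>(t * x0 $ i - u $ i) / N\<rfloor>)"
  define w where "w = u + int N *s z"
  have bound: "\<bar>real_vec w $ i - t * x0 $ i\<bar> \<le> N" for i
  proof -
    let ?a = "(t * x0 $ i - u $ i) / N"
    have "real N * ?a = t * x0 $ i - u $ i" using N(1) by simp
    moreover have "real_vec w $ i = u $ i + real N * of_int \<lfloor>?a\<rfloor>"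
      by (simp add: w_def z_def real_vec_def)
    ultimately have "real_vec w $ i - t * x0 $ i = real N * (of_int \<lfloor>?a\<rfloor> - ?a)"
      unfolding right_diff_distrib by linarith
    moreover have "\<bar>of_int \<lfloor>?a\<rfloor> - ?a\<bar> \<le> 1" by linarith
    ultimately show ?thesis by (simp add: abs_mult mult_left_le)
  qed
  have "norm (real_vec w - t *\<^sub>R x0) \<le> (\<Sum>i\<in>UNIV. \<bar>(real_vec w - t *\<^sub>R x0) $ i\<bar>)"
    by (rule norm_le_l1_cart)
  also have "\<dots> \<le> (\<Sum>i\<in>(UNIV :: 'd set). real N)" using bound by (intro sum_mono) simp
  also have "\<dots> < t * r" using r by (simp add: t_def)
  finally have close: "norm (real_vec w - t *\<^sub>R x0) < t * r" .
  define y where "y = (1 / t) *\<^sub>R real_vec w"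
  have wy: "real_vec w = t *\<^sub>R y" using t by (simp add: y_def)
  have "t * norm (y - x0) < t * r"
    using close t unfolding wy scaleR_diff_right[symmetric] by simp
  then have y: "y \<in> ball x0 r" using t by (simp add: dist_norm norm_minus_commute)
  then have "real_vec w \<in> F" using rays t wy by simp
  moreover have "w \<noteq> 0"
  proof
    assume "w = 0"
    then have "real_vec w = 0" by (simp add: real_vec_def vec_eq_iff)
    then have "y = 0" by (simp add: y_def)
    then show False using y r by simp
  qed
  moreover have "w - u \<in> G" using N(2) by (simp add: w_def)
  ultimately show ?thesis using F by blast
qed

section \<open>Towers climbing through a cone\<close>

text \<open>
  A tower is one stage in the construction of the speedup: it lists the cosets of \<open>G\<close> as
  \<open>w 0, \<dots>, w (n - 1)\<close>, each reached from the previous one by a step in \<open>C\<close>.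
  The speedup is then determined everywhere but on the top coset. The last condition puts the point \<open>T
  (- v) b\<close> in the top coset, while \<open>b\<close> lies in the bottom one; as \<open>G\<close>
  shrinks these two points are what remains, and the speedup sends the first to the second by the step
  \<open>v\<close>. Extending \<open>w\<close> periodically to all of \<open>nat\<close> makes successive
  stages comparable without case distinctions.
\<close>
definition tower :: "(int ^ 'd) set \<Rightarrow> int ^ 'd \<Rightarrow> (int ^ 'd) set \<Rightarrow> nat \<Rightarrow> (nat \<Rightarrow> int ^ 'd) \<Rightarrow> bool" where
  "tower C v G n w \<longleftrightarrow>
     0 < n \<and> w 0 = 0 \<and> (\<forall>i. w (i mod n) = w i) \<and>
     (\<forall>i i'. w i - w i' \<in> G \<longleftrightarrow> i mod n = i' mod n) \<and> (\<forall>u. \<exists>i. u - w i \<in> G) \<and>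
     (\<forall>i. Suc (i mod n) < n \<longrightarrow> w (Suc i) - w i \<in> C) \<and>
     w (n - 1) + v \<in> G"

text \<open>
  The finer tower is made of translates of the coarser one by elements of \<open>G\<close>: within each
  block of \<open>n\<close> consecutive indices, the translation is constant. So the steps already chosen
  are kept.
\<close>
definition tower_refines :: "(int ^ 'd) set \<Rightarrow> nat \<Rightarrow> (nat \<Rightarrow> int ^ 'd) \<Rightarrow> (nat \<Rightarrow> int ^ 'd) \<Rightarrow> bool" where
  "tower_refines G n w w' \<longleftrightarrow>
     (\<forall>i. w' i - w i \<in> G) \<and> (\<forall>i i'. i div n = i' div n \<longrightarrow> w' i - w i = w' i' - w i')"

text \<open>
  All of \<open>w 1, \<dots>, w (n - 1)\<close> are sums of elements of \<open>C\<close>, so \<open>w (n -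
  1) + v\<close> is one as well. Hence \<open>T (- v) b\<close> is never the point \<open>T (w (n - 1))
  b\<close> at which the column of \<open>b\<close> arrives, and a deep enough subgroup tells the two
  columns apart.
\<close>
lemma tower_top_nonzero:
  assumes tower: "tower C v G n w" and v: "v \<in> C" and "0 \<notin> C"
    and add: "\<And>a b. \<lbrakk>a \<in> C; b \<in> C\<rbrakk> \<Longrightarrow> a + b \<in> C"
  shows "w (n - 1) + v \<noteq> 0"
proof -
  have "w i = 0 \<or> w i \<in> C" if "i < n" for i
    using that
  proof (induction i)
    case 0
    then show ?case using tower by (simp add: tower_def)
  next
    case (Suc i)
    then have "w (Suc i) - w i \<in> C" using tower by (simp add: tower_def)
    then show ?case using Suc add[of "w i" "w (Suc i) - w i"] by auto
  qed
  then have "w (n - 1) = 0 \<or> w (n - 1) \<in> C" using tower by (simp add: tower_def)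
  then have "w (n - 1) + v \<in> C" using v add by auto
  then show ?thesis using assms(3) by auto
qed

lemma enumerate_with_ends:
  assumes "finite Q" "a \<in> Q" "b \<in> Q" "a \<noteq> b"
  obtains g where "bij_betw g {..<card Q} Q" "g 0 = a" "g (card Q - 1) = b" "2 \<le> card Q"
proof -
  obtain xs where xs: "set xs = Q - {a, b}" "distinct xs"
    using finite_distinct_list[of "Q - {a, b}"] assms(1) by auto
  let ?ys = "a # xs @ [b]"
  have ys: "distinct ?ys" "set ?ys = Q" using xs assms by auto
  then have len: "card Q = length ?ys" by (metis distinct_card)
  have "bij_betw ((!) ?ys) {..<card Q} Q"
    using ys len by (intro bij_betw_nth) auto
  then show ?thesis by (rule that) (use len in \<open>auto simp: nth_append\<close>)
qed

text \<open>
  Cutting the tower of \<open>G\<close> along the cosets of \<open>H\<close> in \<open>G\<close> gives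
  \<open>q\<close> columns, which are stacked on top of each other. The column of \<open>b\<close> has to
  come first and the column of \<open>T (- v) b\<close> last, which is possible since the assumption on
  \<open>w (n - 1) + v\<close> makes them different. The order of the other columns is arbitrary, and since
  the cone meets every coset of \<open>H\<close>, the top of each column can be joined to the bottom of the
  next by a step in \<open>C\<close>.
\<close>
lemma tower_refinement:
  fixes C :: "(int ^ 'd) set"
  assumes tower: "tower C v G n w"
    and meets: "\<And>u. \<exists>c\<in>C. c - u \<in> H"
    and G: "zd_subgroup G" and H: "zd_subgroup H" "finite (zd_quotient H)" "H \<subseteq> G"
    and top: "w (n - 1) + v \<notin> H"
  obtains n' w' where "tower C v H n' w'" "tower_refines G n w w'"
proof -
  have n: "0 < n" and w0: "w 0 = 0" and periodic: "\<And>i. w (i mod n) = w i"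
    and inj: "\<And>i i'. w i - w i' \<in> G \<longleftrightarrow> i mod n = i' mod n" and surj: "\<And>u. \<exists>i. u - w i \<in> G"
    and incr: "\<And>i. Suc (i mod n) < n \<Longrightarrow> w (Suc i) - w i \<in> C"
    and topG: "w (n - 1) + v \<in> G"
    using tower by (auto simp: tower_def)
  have H0: "0 \<in> H" and G_minus: "\<And>a. a \<in> G \<Longrightarrow> - a \<in> G"
    using H G by (auto simp: zd_subgroup_def)
  have G_add: "a + b \<in> G" if "a \<in> G" "b \<in> G" for a b using that G by (simp add: zd_subgroup_def)
  note coset = coset_eq_iff[OF H(1)]
  define Q where "Q = (\<lambda>g. g +o H) ` G"
  have "Q \<subseteq> zd_quotient H" by (auto simp: Q_def zd_quotient_def)
  then have "finite Q" using H(2) by (rule finite_subset)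
  moreover have "0 +o H \<in> Q" using G unfolding Q_def zd_subgroup_def by (intro imageI) blast
  moreover have "- (w (n - 1) + v) +o H \<in> Q" using G_minus[OF topG] by (auto simp: Q_def)
  moreover have "0 +o H \<noteq> - (w (n - 1) + v) +o H" using top unfolding coset by (simp add: add.commute)
  ultimately obtain g where g: "bij_betw g {..<card Q} Q" "g 0 = 0 +o H"
    "g (card Q - 1) = - (w (n - 1) + v) +o H" and q2: "2 \<le> card Q"
    by (rule enumerate_with_ends)
  define q where "q = card Q"
  have q: "2 \<le> q" and bij: "bij_betw g {..<q} Q" using q2 g by (auto simp: q_def)
  \<comment> \<open>\<open>z a\<close> is the displacement of the bottom of the \<open>a\<close>-th column.\<close>
  have "\<exists>z. \<forall>a. ((a < q \<longrightarrow> z a +o H = g a) \<and> (a = 0 \<longrightarrow> z a = 0)) \<and>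
      (Suc a < q \<longrightarrow> z (Suc a) - (z a + w (n - 1)) \<in> C)"
  proof (rule dependent_nat_choice)
    show "\<exists>x. (0 < q \<longrightarrow> x +o H = g 0) \<and> (0 = 0 \<longrightarrow> x = 0)" using g by simp
    fix x a
    assume "(a < q \<longrightarrow> x +o H = g a) \<and> (a = 0 \<longrightarrow> x = 0)"
    show "\<exists>y. ((Suc a < q \<longrightarrow> y +o H = g (Suc a)) \<and> (Suc a = 0 \<longrightarrow> y = 0)) \<and>
        (Suc a < q \<longrightarrow> y - (x + w (n - 1)) \<in> C)"
    proof (cases "Suc a < q")
      case True
      then have "g (Suc a) \<in> Q" using bij by (auto simp: bij_betw_def)
      then obtain e where e: "g (Suc a) = e +o H" by (auto simp: Q_def)
      obtain c where c: "c \<in> C" "c - (e - (x + w (n - 1))) \<in> H" using meets by blast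
      have "(c + (x + w (n - 1))) +o H = g (Suc a)"
        unfolding e coset using c(2) by (simp add: algebra_simps)
      then show ?thesis using c(1) by (intro exI[of _ "c + (x + w (n - 1))"]) auto
    qed auto
  qed
  then obtain z where z: "\<And>a. a < q \<Longrightarrow> z a +o H = g a" "z 0 = 0"
    and z_incr: "\<And>a. Suc a < q \<Longrightarrow> z (Suc a) - (z a + w (n - 1)) \<in> C"
    by metis
  have zG: "z a \<in> G" if "a < q" for a
  proof -
    have "z a +o H \<in> Q" using z(1)[OF that] bij that by (auto simp: bij_betw_def)
    then obtain e where e: "e \<in> G" "z a - e \<in> H" by (auto simp: Q_def coset)
    then have "e + (z a - e) \<in> G" using H(3) by (intro G_add) auto
    then show ?thesis by simp
  qed
  have z_inj: "a = a'" if "a < q" "a' < q" "z a - z a' \<in> H" for a a'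
  proof -
    have "g a = g a'" using that z(1) coset by metis
    then show ?thesis using bij that by (auto simp: bij_betw_def inj_on_def)
  qed
  define w' where "w' i = w i + z (i div n mod q)" for i
  have split: "i mod (n * q) = n * (i div n mod q) + i mod n" for i by (rule mod_mult2_eq)
  have mod_div: "i mod (n * q) div n = i div n mod q" "i mod (n * q) mod n = i mod n" for i
    using n by (simp_all add: split)
  have w'_periodic: "w' (i mod (n * q)) = w' i" for i
  proof -
    have "w (i mod (n * q)) = w i" by (metis mod_div(2) periodic)
    then show ?thesis by (simp add: w'_def mod_div(1))
  qed
  have "tower C v H (n * q) w'"
    unfolding tower_def
  proof (intro conjI allI impI)
    show "0 < n * q" using n q by simp
    show "w' 0 = 0" using w0 z q by (simp add: w'_def)
    show "w' (i mod (n * q)) = w' i" for i by (rule w'_periodic)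
    show "w' i - w' i' \<in> H \<longleftrightarrow> i mod (n * q) = i' mod (n * q)" for i i'
    proof
      let ?a = "i div n mod q" and ?a' = "i' div n mod q"
      have lt: "?a < q" "?a' < q" using q by auto
      assume *: "w' i - w' i' \<in> H"
      have "(w' i - w' i') + (z ?a' + - z ?a) \<in> G"
        using * H(3) zG lt G_minus by (intro G_add) auto
      then have "w i - w i' \<in> G" by (simp add: w'_def)
      then have eq: "i mod n = i' mod n" using inj by simp
      then have "w i = w i'" by (metis periodic)
      then have "z ?a - z ?a' \<in> H" using * by (simp add: w'_def)
      then show "i mod (n * q) = i' mod (n * q)" using z_inj lt eq split by metis
    next
      assume "i mod (n * q) = i' mod (n * q)"
      then have "w' i = w' i'" by (metis w'_periodic)
      then show "w' i - w' i' \<in> H" using H0 by simp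
    qed
    show "\<exists>i. u - w' i \<in> H" for u
    proof -
      obtain i0 where i0: "u - w i0 \<in> G" using surj by blast
      then have "(u - w i0) +o H \<in> Q" by (auto simp: Q_def)
      then obtain a where a: "a < q" "(u - w i0) +o H = z a +o H"
        using bij z(1) by (metis bij_betw_imp_surj_on imageE lessThan_iff)
      have "w' (n * a + i0 mod n) = w i0 + z a"
        using a n periodic[of "n * a + i0 mod n"] periodic[of i0] by (simp add: w'_def)
      then show ?thesis using a(2) by (intro exI[of _ "n * a + i0 mod n"]) (simp add: coset algebra_simps)
    qed
    show "w' (Suc i) - w' i \<in> C" if i: "Suc (i mod (n * q)) < n * q" for i
    proof (cases "Suc (i mod n) < n")
      case True
      then have "Suc i div n = i div n" by (simp add: div_Suc mod_Suc)
      then show ?thesis using incr[OF True] by (simp add: w'_def)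
    next
      case False
      then have last: "i mod n = n - 1" using n by (metis Suc_lessI Suc_diff_1 mod_less_divisor less_antisym diff_Suc_1)
      then have Suc_mod: "Suc i mod n = 0" and Suc_div: "Suc i div n = Suc (i div n)"
        using n by (auto simp: mod_Suc div_Suc)
      let ?a = "i div n mod q"
      have "n * ?a + n < n * q" using i n last by (simp add: split)
      then have "n * Suc ?a < n * q" by simp
      then have a: "Suc ?a < q" by (simp only: nat_mult_less_cancel1[OF n])
      then have "Suc (i div n) mod q = Suc ?a" by (simp add: mod_Suc)
      moreover have "w (Suc i) = 0" "w i = w (n - 1)" using periodic Suc_mod last w0 by metis+
      ultimately have "w' (Suc i) - w' i = z (Suc ?a) - (z ?a + w (n - 1))"
        by (simp add: w'_def Suc_div)
      then show ?thesis using z_incr[OF a] by simp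
    qed
    show "w' (n * q - 1) + v \<in> H"
    proof -
      have e: "n * q - 1 = n * (q - 1) + (n - 1)" using n q by (simp add: diff_mult_distrib2)
      have "(n * a + r) div n = a" "(n * a + r) mod n = r" if "r < n" for a r
        using that by simp_all
      then have "(n * (q - 1) + (n - 1)) div n = q - 1" "(n * (q - 1) + (n - 1)) mod n = n - 1"
        using n by (metis diff_less zero_less_one)+
      then have "w' (n * q - 1) = w (n - 1) + z (q - 1)"
        using periodic[of "n * (q - 1) + (n - 1)"] q unfolding w'_def e by simp
      moreover have "z (q - 1) +o H = - (w (n - 1) + v) +o H"
        using z(1)[of "q - 1"] g(3) q by (simp add: q_def)
      ultimately show ?thesis by (simp add: coset algebra_simps)
    qed
  qed
  moreover have "tower_refines G n w w'"
    using zG q by (auto simp: tower_refines_def w'_def)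
  ultimately show ?thesis by (rule that)
qed

context odometer_levels
begin

text \<open>
  The construction starts from the tower of height one over the whole group. Each stage goes to a subgroup
  so deep that the column condition of the refinement step holds.
\<close>
lemma tower_sequence:
  assumes free: "free_action X T" and v: "v \<in> C" and C0: "0 \<notin> C"
    and add: "\<And>a b. \<lbrakk>a \<in> C; b \<in> C\<rbrakk> \<Longrightarrow> a + b \<in> C"
    and meets: "\<And>j u. \<exists>c\<in>C. c - u \<in> G j"
  obtains k n w where "\<And>j. j \<le> k j" "\<And>j. k j \<le> k (Suc j)"
    "\<And>j. tower C v (G (k j)) (n j) (w j)"
    "\<And>j. tower_refines (G (k j)) (n j) (w j) (w (Suc j))"
proof -
  have extend: "\<exists>k n' w'. k0 \<le> k \<and> tower C v (G k) n' w' \<and> tower_refines K n w w'"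
    if tow: "tower C v K n w" and K: "zd_subgroup K" "\<And>k. k0 \<le> k \<Longrightarrow> G k \<subseteq> K" for K n w k0
  proof -
    obtain j where "w (n - 1) + v \<notin> G j"
      using trivial_intersection[OF free] tower_top_nonzero[OF tow v C0 add] by blast
    then have "w (n - 1) + v \<notin> G (max j k0)" using G_antimono[of j "max j k0"] by auto
    then show ?thesis
      using tower_refinement[OF tow meets K(1) subgroup finite_index, of "max j k0"] K(2)
      by (metis max.cobounded2)
  qed
  let ?P = "\<lambda>j (k, n, w). j \<le> k \<and> tower C v (G k) n w"
  let ?R = "\<lambda>j (k, n, w) (k', n', w'). k \<le> k' \<and> tower_refines (G k) n w w'"
  have "\<exists>s. \<forall>j. ?P j (s j) \<and> ?R j (s j) (s (Suc j))"
  proof (rule dependent_nat_choice)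
    have "tower C v UNIV 1 (\<lambda>_. 0)" by (simp add: tower_def)
    then obtain k n w where "tower C v (G k) n w"
      using extend[of UNIV 1 "\<lambda>_. 0" 0] by (auto simp: zd_subgroup_def)
    then show "\<exists>s. ?P 0 s" by (intro exI[of _ "(k, n, w)"]) simp
    fix s j assume "?P j s"
    then obtain k n w where s: "s = (k, n, w)" "j \<le> k" "tower C v (G k) n w" by (cases s) auto
    then obtain k' n' w' where "max k (Suc j) \<le> k'" "tower C v (G k') n' w'" "tower_refines (G k) n w w'"
      using extend[OF s(3) subgroup, of "max k (Suc j)"] G_antimono by auto
    then show "\<exists>s'. ?P (Suc j) s' \<and> ?R j s s'"
      using s by (intro exI[of _ "(k', n', w')"]) simp
  qed
  then obtain s where "\<forall>j. ?P j (s j) \<and> ?R j (s j) (s (Suc j))" ..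
  then have s: "?P j (s j)" "?R j (s j) (s (Suc j))" for j by auto
  show ?thesis
  proof (rule that[of "\<lambda>j. fst (s j)" "\<lambda>j. fst (snd (s j))" "\<lambda>j. snd (snd (s j))"])
    fix j
    show "j \<le> fst (s j)" "tower C v (G (fst (s j))) (fst (snd (s j))) (snd (snd (s j)))"
      using s(1)[of j] by (auto simp: case_prod_beta)
    show "fst (s j) \<le> fst (s (Suc j))"
      "tower_refines (G (fst (s j))) (fst (snd (s j))) (snd (snd (s j))) (snd (snd (s (Suc j))))"
      using s(2)[of j] by (auto simp: case_prod_beta)
  qed
qed

text \<open>
  The core of the construction: the space of a free odometer carries cyclic labels such that the map which
  increases every label by one moves each point by an element of the cone. Unless the labels of
  \<open>x\<close> are maximal at all levels, some level has a step of the tower leading from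
  \<open>x\<close> to the next label, and refinement keeps that step at all deeper levels. If they are
  maximal at all levels, then \<open>x\<close> is \<open>T (- v) b\<close> and the step \<open>v\<close>
  leads to \<open>b\<close>, all of whose labels are zero.
\<close>
lemma cone_numbering:
  assumes free: "free_action X T" and C0: "0 \<notin> C"
    and add: "\<And>a b. \<lbrakk>a \<in> C; b \<in> C\<rbrakk> \<Longrightarrow> a + b \<in> C"
    and meets: "\<And>j u. \<exists>c\<in>C. c - u \<in> G j"
  obtains n l where "cyclic_levels X n l"
    "\<And>j v x y. \<lbrakk>x \<in> topspace X; y \<in> topspace X\<rbrakk> \<Longrightarrow> l j (T v x) = l j (T v y) \<longleftrightarrow> l j x = l j y"
    "\<And>x y. \<lbrakk>x \<in> topspace X; y \<in> topspace X; \<And>j. l j y = (l j x + 1) mod n j\<rbrakk> \<Longrightarrow> \<exists>u\<in>C. y = T u x"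
proof -
  obtain v where v: "v \<in> C" using meets by blast
  obtain k n w where k: "\<And>j. j \<le> k j" "\<And>j. k j \<le> k (Suc j)"
    and tow: "\<And>j. tower C v (G (k j)) (n j) (w j)"
    and ref: "\<And>j. tower_refines (G (k j)) (n j) (w j) (w (Suc j))"
    using tower_sequence[OF free v C0 add meets] by metis
  interpret odometer_numbering X T G c b k n w
  proof
    fix j
    show "j \<le> k j" "k j \<le> k (Suc j)" by (rule k)+
    show "0 < n j" "\<exists>i. u - w j i \<in> G (k j)"
      "w j i - w j i' \<in> G (k j) \<longleftrightarrow> i mod n j = i' mod n j" for u i i'
      using tow[of j] unfolding tower_def by blast+
    show "w (Suc j) i - w j i \<in> G (k j)" for i
      using ref[of j] unfolding tower_refines_def by blast
  qed
  interpret L: cyclic_levels X n number by (rule cyclic)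
  have block: "w J i - w j i = w J i' - w j i'" if "j \<le> J" "i div n j = i' div n j" for j J i i'
    using that(1)
  proof (induction J rule: dec_induct)
    case base
    then show ?case by simp
  next
    case (step J)
    obtain q where q: "n J = n j * q" using L.dvd_le[OF step(1)] by (rule dvdE)
    have "i div n J = i' div n J" using that(2) by (simp add: q div_mult2_eq)
    then have "w (Suc J) i - w J i = w (Suc J) i' - w J i'"
      using ref[of J] unfolding tower_refines_def by blast
    then have "(w (Suc J) i - w J i) + (w J i - w j i) = (w (Suc J) i' - w J i') + (w J i' - w j i')"
      using step.IH by (simp only:)
    then show ?case by simp
  qed
  have next_point: "\<exists>u\<in>C. y = T u x"
    if x: "x \<in> topspace X" and y: "y \<in> topspace X" and yx: "\<And>j. number j y = (number j x + 1) mod n j" for x y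
  proof (cases "\<exists>j. Suc (number j x) < n j")
    case True
    then obtain j where j: "Suc (number j x) < n j" by blast
    let ?i = "number j x"
    define u where "u = w j (Suc ?i) - w j ?i"
    have "?i mod n j = ?i" using j by simp
    then have "u \<in> C" using tow[of j] j unfolding tower_def u_def by metis
    have high: "number J y = number J (T u x)" if J: "j \<le> J" for J
    proof -
      let ?I = "number J x"
      have I: "?I mod n j = ?i" using L.label_mod[OF J x] .
      then have "Suc ?I div n j = ?I div n j" "Suc ?I mod n j = Suc ?i"
        using j by (auto simp: div_Suc mod_Suc)
      then have "w J (Suc ?I) - w J ?I = w j (Suc ?I) - w j ?I"
        using block[OF J, of "Suc ?I" ?I] by (simp add: algebra_simps)
      also have "\<dots> = u"
        using tow[of j] I \<open>Suc ?I mod n j = Suc ?i\<close> unfolding tower_def u_def by metis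
      finally have "u + w J ?I = w J (Suc ?I)" by (simp add: algebra_simps)
      then have "c (k J) (T u x) = w J (Suc ?I) +o G (k J)"
        using coset_translate_eq[OF x coset_number[OF x, of J], of u] by simp
      then show ?thesis using number_eqI yx by simp
    qed
    have "y = T u x"
    proof (rule L.separating[OF y T_in[OF x]])
      show "number J y = number J (T u x)" for J
        using L.label_eq_le[of J "max j J" y "T u x"] y T_in[OF x] high[of "max j J"] by simp
    qed
    then show ?thesis using \<open>u \<in> C\<close> by blast
  next
    case False
    have top: "number j x = n j - 1" for j
      using False number_less[of j x] by (metis Suc_lessI diff_Suc_1)
    have "y = T v x"
    proof (rule L.separating[OF y T_in[OF x]])
      fix j
      have "(v + w j (n j - 1)) - w j 0 \<in> G (k j)"
        using tow[of j] by (simp add: tower_def add.commute)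
      then have "c (k j) (T v x) = w j 0 +o G (k j)"
        using coset_translate_eq[OF x coset_number[OF x, of j], of v] by (simp add: top coset_eq_iff[OF subgroup])
      then have "number j (T v x) = 0" using number_eqI by simp
      moreover have "number j y = 0" using yx[of j] n_pos[of j] by (simp add: top)
      ultimately show "number j y = number j (T v x)" by simp
    qed
    then show ?thesis using v by blast
  qed
  show ?thesis
    using that[OF cyclic] number_translate_iff next_point by blast
qed

end

section \<open>From conjugate actions to speedups\<close>

lemma conjugate_zd_action:
  fixes T :: "int ^ 'e \<Rightarrow> 'b \<Rightarrow> 'b"
  assumes T: "zd_action Y T" and maps: "homeomorphic_maps X Y f g"
  shows "zd_action X (\<lambda>v x. g (T v (f x)))"
proof -
  have f: "homeomorphic_map X Y f" and g: "homeomorphic_map Y X g"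
    and gf: "\<And>x. x \<in> topspace X \<Longrightarrow> g (f x) = x" and fg: "\<And>y. y \<in> topspace Y \<Longrightarrow> f (g y) = y"
    using maps by (auto simp: homeomorphic_maps_map)
  have T_hom: "homeomorphic_map Y Y (T v)" for v using T by (simp add: zd_action_def)
  have fY: "f x \<in> topspace Y" if "x \<in> topspace X" for x
    using homeomorphic_imp_surjective_map[OF f] that by blast
  have TY: "T v y \<in> topspace Y" if "y \<in> topspace Y" for v y
    using homeomorphic_imp_surjective_map[OF T_hom] that by blast
  have "homeomorphic_map X X (\<lambda>x. g (T v (f x)))" for v
    using homeomorphic_map_compose[OF homeomorphic_map_compose[OF f T_hom[of v]] g] by (simp add: o_def)
  then show ?thesis
    using T gf fg fY TY unfolding zd_action_def by simp
qed

text \<open>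
  Freeness makes the vector \<open>u\<close> with \<open>S v x = T u x\<close> unique, and the cocycle
  identity is this uniqueness applied to \<open>S (v + w) x\<close>.
\<close>
lemma speedup_by_freeness:
  assumes T: "zd_action X T" "free_action X T" and S: "zd_action X S"
    and orbit: "\<And>x v. x \<in> topspace X \<Longrightarrow> \<exists>u. S v x = T u x"
    and generators: "\<And>x j. x \<in> topspace X \<Longrightarrow> \<exists>u\<in>C. S (axis j 1) x = T u x"
  shows "cone_speedup C X T S"
proof -
  have T_add: "T (v + w) x = T v (T w x)" and T_zero: "T 0 x = x" if "x \<in> topspace X" for v w x
    using T that by (auto simp: zd_action_def)
  have T_in: "T v x \<in> topspace X" if "x \<in> topspace X" for v x
    using T that homeomorphic_imp_surjective_map unfolding zd_action_def by blast
  have S_add: "S (v + w) x = S v (S w x)" and S_zero: "S 0 x = x" if "x \<in> topspace X" for v w x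
    using S that by (auto simp: zd_action_def)
  note cancel = free_action_cancel[OF T]
  define p where "p x v = (SOME u. S v x = T u x)" for x v
  have p: "S v x = T (p x v) x" if "x \<in> topspace X" for x v
    unfolding p_def using someI_ex[OF orbit[OF that]] .
  have p_eq: "p x v = u" if "x \<in> topspace X" "S v x = T u x" for x v u
    using cancel p that by metis
  have "speedup_cocycle X T p"
    unfolding speedup_cocycle_def
  proof (intro ballI conjI allI)
    fix x v w assume x: "x \<in> topspace X"
    show "p x 0 = 0" using x S_zero T_zero by (intro p_eq) auto
    have "S (v + w) x = S w (S v x)" using S_add[OF x, of w v] by (simp add: add.commute)
    also have "\<dots> = T (p (S v x) w) (S v x)" using p T_in x by metis
    also have "\<dots> = T (p (T (p x v) x) w + p x v) x" using p[OF x] T_add[OF x] by simp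
    finally show "p x v + p (T (p x v) x) w = p x (v + w)"
      using p_eq[OF x] by (simp add: add.commute)
  qed
  moreover have "p x (axis j 1) \<in> C" if "x \<in> topspace X" for x j
    using generators[OF that, of j] p_eq[OF that] by metis
  ultimately show ?thesis using S p unfolding cone_speedup_def by blast
qed

text \<open>
  Negative times reduce to positive ones: \<open>x\<close> lies on the forward orbit of \<open>S v
  x\<close>.
\<close>
lemma int1_action_orbit:
  fixes S :: "int ^ 1 \<Rightarrow> 'a \<Rightarrow> 'a"
  assumes T: "zd_action X T" and S: "zd_action X S"
    and step: "\<And>x. x \<in> topspace X \<Longrightarrow> \<exists>u. S (vec 1) x = T u x"
    and x: "x \<in> topspace X"
  shows "\<exists>u. S v x = T u x"
proof -
  have T_add: "T (v + w) x = T v (T w x)" and T_zero: "T 0 x = x" if "x \<in> topspace X" for v w x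
    using T that by (auto simp: zd_action_def)
  have S_add: "S (v + w) x = S v (S w x)" and S_zero: "S 0 x = x" if "x \<in> topspace X" for v w x
    using S that by (auto simp: zd_action_def)
  have S_in: "S v x \<in> topspace X" if "x \<in> topspace X" for v x
    using S that homeomorphic_imp_surjective_map unfolding zd_action_def by blast
  have Suc: "vec (int (Suc k)) = (vec 1 + vec (int k) :: int ^ 1)" for k by (simp add: vec_eq_iff)
  have forward: "\<exists>u. S (vec (int k)) x = T u x" if x: "x \<in> topspace X" for k x
  proof (induction k)
    case 0
    have "vec (int 0) = (0 :: int ^ 1)" by (simp add: vec_eq_iff)
    then have "S (vec (int 0)) x = T 0 x" using S_zero[OF x] T_zero[OF x] by simp
    then show ?case by blast
  next
    case (Suc k)
    then obtain u where u: "S (vec (int k)) x = T u x" by blast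
    obtain u' where "S (vec 1) (S (vec (int k)) x) = T u' (S (vec (int k)) x)"
      using step S_in x by blast
    then have "S (vec (int (Suc k))) x = T (u' + u) x"
      unfolding \<open>vec (int (Suc k)) = _\<close> using S_add[OF x] T_add[OF x] u by simp
    then show ?case by blast
  qed
  have v: "v = vec (v $ 1)" by (simp add: vec_eq_iff)
  show ?thesis
  proof (cases "0 \<le> v $ 1")
    case True
    then show ?thesis using forward[OF x, of "nat (v $ 1)"] v by simp
  next
    case False
    let ?k = "nat (- v $ 1)"
    have neg: "vec (int ?k) + v = 0" using False by (simp add: vec_eq_iff)
    obtain u where u: "S (vec (int ?k)) (S v x) = T u (S v x)" using forward S_in x by blast
    have "S (vec (int ?k)) (S v x) = x" using S_add[OF x] S_zero[OF x] neg by metis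
    then have "T (- u) x = T (- u) (T u (S v x))" using u by simp
    also have "\<dots> = S v x" using T_add[OF S_in[OF x]] T_zero[OF S_in[OF x]] by (metis add.left_inverse)
    finally show ?thesis by metis
  qed
qed

theorem theoremC:
  fixes X1 :: "'a topology" and T1 :: "int ^ 'd \<Rightarrow> 'a \<Rightarrow> 'a"
    and X2 :: "'b topology" and T2 :: "int ^ 1 \<Rightarrow> 'b \<Rightarrow> 'b"
    and C :: "(int ^ 'd) set"
  assumes "odometer X1 T1" and "free_action X1 T1"
    and "odometer X2 T2" and "free_action X2 T2"
    and "orbit_equivalent X1 T1 X2 T2"
    and "zd_cone C"
  shows "\<exists>S :: int ^ 1 \<Rightarrow> 'a \<Rightarrow> 'a. cone_speedup C X1 T1 S \<and> conjugate_actions X1 S X2 T2"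
proof -
  obtain G1 c1 b1 where "odometer_levels X1 T1 G1 c1 b1"
    using odometer_imp_levels[OF assms(1)] by blast
  then interpret O1: odometer_levels X1 T1 G1 c1 b1 .
  obtain G2 c2 b2 where "odometer_levels X2 T2 G2 c2 b2"
    using odometer_imp_levels[OF assms(3)] by blast
  then interpret O2: odometer_levels X2 T2 G2 c2 b2 .
  obtain m l2 where l2: "cyclic_levels X2 m l2"
    and rotation: "\<And>j y. y \<in> topspace X2 \<Longrightarrow> l2 j (T2 (vec 1) y) = (l2 j y + 1) mod m j"
    using Z_odometer_cyclic[OF O2.odometer_levels_axioms] by blast
  have C0: "0 \<notin> C" and C_add: "\<And>a b. \<lbrakk>a \<in> C; b \<in> C\<rbrakk> \<Longrightarrow> a + b \<in> C"
    using assms(6) by (auto simp: zd_cone_def)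
  obtain n l1 where l1: "cyclic_levels X1 n l1"
    and perm: "\<And>j v x y. \<lbrakk>x \<in> topspace X1; y \<in> topspace X1\<rbrakk>
      \<Longrightarrow> l1 j (T1 v x) = l1 j (T1 v y) \<longleftrightarrow> l1 j x = l1 j y"
    and next_point: "\<And>x y. \<lbrakk>x \<in> topspace X1; y \<in> topspace X1; \<And>j. l1 j y = (l1 j x + 1) mod n j\<rbrakk>
      \<Longrightarrow> \<exists>u\<in>C. y = T1 u x"
    using O1.cone_numbering[OF assms(2) C0 C_add cone_meets_coset[OF assms(6) O1.subgroup O1.finite_index]]
    by blast
  interpret L1: cyclic_levels X1 n l1 by (rule l1)
  interpret L1: level_permuting_action X1 n l1 T1
    by unfold_locales (use countable_int_vectors O1.T_homeomorphic perm free_action_cancel[OF O1.action assms(2)] in auto)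
  obtain \<Phi> where \<Phi>: "homeomorphic_map X1 X2 \<Phi>"
    and orbits: "\<And>x. x \<in> topspace X1 \<Longrightarrow> \<Phi> ` range (\<lambda>v. T1 v x) = range (\<lambda>v. T2 v (\<Phi> x))"
    using assms(5) unfolding orbit_equivalent_def by blast
  have step: "\<exists>v. T2 (vec 1) (\<Phi> x) = \<Phi> (T1 v x)" if "x \<in> topspace X1" for x
  proof -
    have "T2 (vec 1) (\<Phi> x) \<in> \<Phi> ` range (\<lambda>v. T1 v x)" using orbits[OF that] by blast
    then show ?thesis by blast
  qed
  note cofinal = L1.orbit_equivalence_cofinal[OF l2 O2.T_homeomorphic rotation \<Phi> step]
  obtain K where K: "cyclic_levels X2 n (\<lambda>j y. l2 (K j) y mod n j)" "\<And>j. n j dvd m (K j)"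
    using cyclic_levels_relevel[OF l2 L1.pos L1.dvd_Suc cofinal] by blast
  obtain \<Theta> where \<Theta>: "homeomorphic_map X1 X2 \<Theta>"
    and label: "\<And>x j. x \<in> topspace X1 \<Longrightarrow> l2 (K j) (\<Theta> x) mod n j = l1 j x"
    using cyclic_levels_homeomorphic[OF l1 K(1)] by blast
  obtain \<Theta>' where maps: "homeomorphic_maps X1 X2 \<Theta> \<Theta>'" using \<Theta> homeomorphic_map_maps by blast
  then have inv: "\<And>y. y \<in> topspace X2 \<Longrightarrow> \<Theta> (\<Theta>' y) = y"
    and \<Theta>'_in: "\<And>y. y \<in> topspace X2 \<Longrightarrow> \<Theta>' y \<in> topspace X1"
    and \<Theta>_in: "\<And>x. x \<in> topspace X1 \<Longrightarrow> \<Theta> x \<in> topspace X2"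
    using homeomorphic_imp_surjective_map by (auto simp: homeomorphic_maps_map) blast+
  define S where "S v x = \<Theta>' (T2 v (\<Theta> x))" for v x
  have S: "zd_action X1 S"
    unfolding S_def by (rule conjugate_zd_action[OF O2.action maps])
  have \<Theta>S: "\<Theta> (S v x) = T2 v (\<Theta> x)" if "x \<in> topspace X1" for v x
    using inv O2.T_in \<Theta>_in that by (simp add: S_def)
  have S_in: "S v x \<in> topspace X1" if "x \<in> topspace X1" for v x
    using \<Theta>'_in O2.T_in \<Theta>_in that by (simp add: S_def)
  have S_step: "\<exists>u\<in>C. S (vec 1) x = T1 u x" if x: "x \<in> topspace X1" for x
  proof (rule next_point[OF x S_in[OF x]])
    fix j
    have "l1 j (S (vec 1) x) = l2 (K j) (\<Theta> (S (vec 1) x)) mod n j"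
      using label[OF S_in[OF x]] by simp
    also have "\<dots> = (l2 (K j) (\<Theta> x) + 1) mod m (K j) mod n j"
      unfolding \<Theta>S[OF x] rotation[OF \<Theta>_in[OF x]] ..
    also have "\<dots> = (l2 (K j) (\<Theta> x) + 1) mod n j" by (rule mod_mod_cancel[OF K(2)])
    also have "\<dots> = (l2 (K j) (\<Theta> x) mod n j + 1) mod n j" by (rule mod_add_left_eq[symmetric])
    finally show "l1 j (S (vec 1) x) = (l1 j x + 1) mod n j" by (simp only: label[OF x])
  qed
  have axis: "axis j 1 = (vec 1 :: int ^ 1)" for j by (simp add: vec_eq_iff axis_def)
  have "cone_speedup C X1 T1 S"
  proof (rule speedup_by_freeness[OF O1.action assms(2) S])
    have "\<exists>u. S (vec 1) x = T1 u x" if "x \<in> topspace X1" for x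
      using S_step[OF that] by (elim bexE exI)
    then show "\<exists>u. S v x = T1 u x" if "x \<in> topspace X1" for x v
      using int1_action_orbit[OF O1.action S _ that, of v] by simp
    show "\<exists>u\<in>C. S (axis j 1) x = T1 u x" if "x \<in> topspace X1" for x j
      unfolding axis using S_step that .
  qed
  moreover have "conjugate_actions X1 S X2 T2"
    unfolding conjugate_actions_def using \<Theta> \<Theta>S by blast
  ultimately show ?thesis by blast
qed

end
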